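(* Let $X$ be a weakly sequentially complete complex Banach space with open unit ball $B$, let $\omega\in\mathbb{R}$ and $h\in\mathrm{Hol}(B,X)$. Then $h$ is $\omega$-dissipative if and only if it is $\omega$-pseudo-contractive.
   Context: $X^*$ is the dual of $X$, $\langle x,x^*\rangle$ the value of $x^*\in X^*$ at $x\in X$, $B=\{x\in X:\|x\|<1\}$, and $J(x)=\{x^*\in X^*:\|x\|^2=\langle x,x^*\rangle=\|x^*\|^2\}$. $\mathrm{Hol}(B,W)$ is the set of holomorphic (i.e. complex Fréchet differentiable at each point) maps from $B$ into $W\subseteq X$, and $\mathrm{Hol}(B)=\mathrm{Hol}(B,B)$. $h$ is $\omega$-dissipative if there are $\varepsilon>0$ and $\varsigma\in\mathbb{R}$ such that for each $x\in B$ with $1-\varepsilon<\|x\|<1$ and all $x^*\in J(x)$: $\mathrm{Re}\langle h(x),x^*\rangle\le\omega\|x\|^2+\varsigma(1-\|x\|^2)$. Abel average: for real $\alpha$ with $\alpha\omega\ne1$, $\Phi_\alpha=(I-\alpha h)^{-1}\circ[(1-\alpha\omega)I]$. That is, $\Phi_\alpha(x)$ is the unique $y\in B$ with $y-\alpha h(y)=(1-\alpha\omega)x$; "$\Phi_\alpha\in\mathrm{Hol}(B)$" means that such a unique $y\in B$ exists for every $x\in B$ and that $x\mapsto y$ is holomorphic. $h$ is $\omega$-pseudo-contractive if there exists $\delta>0$ such that $\Phi_\alpha\in\mathrm{Hol}(B)$ for each $\alpha\in(0,\delta)$. *)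

theory Defs
  imports "HOL-Analysis.Analysis"
begin

class scaleC =
  fixes scaleC :: "complex \<Rightarrow> 'a \<Rightarrow> 'a" (infixr "*\<^sub>C" 75)

text \<open>
  The norm, metric and real scalar multiplication are those of the underlying real normed space;
  the axiom \<open>scaleR_scaleC\<close> makes the complex scalar multiplication extend the real one.
\<close>

class complex_normed_vector = real_normed_vector + scaleC +
  assumes scaleC_add_right: "c *\<^sub>C (x + y) = c *\<^sub>C x + c *\<^sub>C y"
    and scaleC_add_left: "(c + d) *\<^sub>C x = c *\<^sub>C x + d *\<^sub>C x"
    and scaleC_scaleC: "c *\<^sub>C d *\<^sub>C x = (c * d) *\<^sub>C x"
    and scaleR_scaleC: "r *\<^sub>R x = complex_of_real r *\<^sub>C x"
    and norm_scaleC: "norm (c *\<^sub>C x) = cmod c * norm x"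

class complex_banach = complex_normed_vector + complete_space

instantiation complex :: complex_banach
begin

definition scaleC_complex :: "complex \<Rightarrow> complex \<Rightarrow> complex"
  where "scaleC_complex c z = c * z"

instance
  by standard (simp_all add: scaleC_complex_def algebra_simps scaleR_conv_of_real norm_mult)

end

definition bounded_clinear ::
    "('a::complex_normed_vector \<Rightarrow> 'b::complex_normed_vector) \<Rightarrow> bool"
  where "bounded_clinear f \<longleftrightarrow> bounded_linear f \<and> (\<forall>c x. f (c *\<^sub>C x) = c *\<^sub>C f x)"

text \<open>
  Elements of the dual are represented as functions; the dual norm is \<^const>\<open>onorm\<close>.
\<close>

definition cdual :: "('a::complex_normed_vector \<Rightarrow> complex) set"
  where "cdual = {f. bounded_clinear f}"

definition duality_map :: "'a::complex_normed_vector \<Rightarrow> ('a \<Rightarrow> complex) set"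
  where "duality_map x =
    {f \<in> cdual. complex_of_real ((norm x)\<^sup>2) = f x \<and> f x = complex_of_real ((onorm f)\<^sup>2)}"

definition weakly_Cauchy :: "(nat \<Rightarrow> 'a::complex_normed_vector) \<Rightarrow> bool"
  where "weakly_Cauchy s \<longleftrightarrow> (\<forall>f\<in>cdual. Cauchy (\<lambda>n. f (s n)))"

definition weakly_tendsto :: "(nat \<Rightarrow> 'a::complex_normed_vector) \<Rightarrow> 'a \<Rightarrow> bool"
  where "weakly_tendsto s l \<longleftrightarrow> (\<forall>f\<in>cdual. (\<lambda>n. f (s n)) \<longlonglongrightarrow> f l)"

definition weakly_sequentially_complete :: "'a::complex_normed_vector itself \<Rightarrow> bool"
  where "weakly_sequentially_complete T \<longleftrightarrow>
    (\<forall>s :: nat \<Rightarrow> 'a. weakly_Cauchy s \<longrightarrow> (\<exists>l. weakly_tendsto s l))"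

text \<open>
  Maps on \<open>D\<close> are total functions whose values off \<open>D\<close> are irrelevant. The derivative is taken
  without restriction to \<open>D\<close>, so \<open>Hol D W\<close> is meant for open \<open>D\<close>.
\<close>

definition Hol :: "'a::complex_normed_vector set \<Rightarrow> 'b::complex_normed_vector set \<Rightarrow> ('a \<Rightarrow> 'b) set"
  where "Hol D W =
    {f. (\<forall>x\<in>D. f x \<in> W) \<and>
        (\<forall>x\<in>D. \<exists>f'. bounded_clinear f' \<and> (f has_derivative f') (at x))}"

abbreviation unit_ball :: "'a::complex_normed_vector set"
  where "unit_ball \<equiv> ball 0 1"

definition dissipative :: "real \<Rightarrow> ('a::complex_normed_vector \<Rightarrow> 'a) \<Rightarrow> bool"
  where "dissipative \<omega> h \<longleftrightarrow>
    (\<exists>\<epsilon>>0. \<exists>\<sigma>::real. \<forall>x\<in>unit_ball. 1 - \<epsilon> < norm x \<and> norm x < 1 \<longrightarrow>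
      (\<forall>f\<in>duality_map x. Re (f (h x)) \<le> \<omega> * (norm x)\<^sup>2 + \<sigma> * (1 - (norm x)\<^sup>2)))"

definition abel_eq :: "real \<Rightarrow> ('a::complex_normed_vector \<Rightarrow> 'a) \<Rightarrow> real \<Rightarrow> 'a \<Rightarrow> 'a \<Rightarrow> bool"
  where "abel_eq \<omega> h \<alpha> x y \<longleftrightarrow> y - \<alpha> *\<^sub>R h y = (1 - \<alpha> * \<omega>) *\<^sub>R x"

definition abel_average :: "real \<Rightarrow> ('a::complex_normed_vector \<Rightarrow> 'a) \<Rightarrow> real \<Rightarrow> 'a \<Rightarrow> 'a"
  where "abel_average \<omega> h \<alpha> x = (THE y. y \<in> unit_ball \<and> abel_eq \<omega> h \<alpha> x y)"

text \<open>
  The Abel average is only considered when \<open>\<alpha> * \<omega> \<noteq> 1\<close>. Requiring this for every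
  \<open>\<alpha> \<in> (0, \<delta>)\<close> in the definition of pseudo-contractivity is harmless, since \<open>\<delta>\<close> may be
  decreased.
\<close>

definition abel_average_in_Hol :: "real \<Rightarrow> ('a::complex_normed_vector \<Rightarrow> 'a) \<Rightarrow> real \<Rightarrow> bool"
  where "abel_average_in_Hol \<omega> h \<alpha> \<longleftrightarrow>
    \<alpha> * \<omega> \<noteq> 1 \<and>
    (\<forall>x\<in>unit_ball. \<exists>!y. y \<in> unit_ball \<and> abel_eq \<omega> h \<alpha> x y) \<and>
    abel_average \<omega> h \<alpha> \<in> Hol unit_ball unit_ball"

definition pseudo_contractive :: "real \<Rightarrow> ('a::complex_normed_vector \<Rightarrow> 'a) \<Rightarrow> bool"
  where "pseudo_contractive \<omega> h \<longleftrightarrow>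
    (\<exists>\<delta>>0. \<forall>\<alpha>. 0 < \<alpha> \<and> \<alpha> < \<delta> \<longrightarrow> abel_average_in_Hol \<omega> h \<alpha>)"

end

theory Submission
  imports Defs "HOL-Complex_Analysis.Riemann_Mapping"
begin

text \<open>
  The Hahn-Banach theorem shows that dissipativity is not vacuous. If \<open>h\<close> is dissipative, the
  estimate on a sphere close to the boundary propagates inwards along complex lines: reflecting
  the pole of \<open>\<langle>h(\<zeta>v), v*\<rangle>/\<zeta>\<close> at \<open>0\<close> across the circle gives a holomorphic function with bounded
  real part, so the numerical range of \<open>h\<close> is bounded on smaller balls. Harris' argument, applied
  to the averages of \<open>h\<close> over roots of unity, turns this into geometric bounds on Taylor
  coefficients, hence \<open>h\<close> itself is bounded on smaller balls. Now
  \<open>f(y) = y - \<alpha>h(y) - (1 - \<alpha>\<omega>)x\<close> satisfies \<open>Re \<langle>f(y), y*\<rangle> \<ge> c > 0\<close> near a sphere, so for small \<open>\<tau>\<close> the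
  Euler step \<open>I - \<tau>f\<close> maps the ball strictly inside itself, and the Earle-Hamilton theorem gives a
  unique zero of \<open>f\<close>, depending holomorphically on \<open>x\<close>.

  Conversely, the Schwarz-Pick lemma applied to the self-map \<open>\<Phi>\<^sub>\<alpha>\<close> along a complex line gives
  \<open>Re \<langle>\<Phi>\<^sub>\<alpha>(x), x*\<rangle> - \<parallel>x\<parallel>\<^sup>2 \<le> \<parallel>\<Phi>\<^sub>\<alpha>(0)\<parallel>(1 - \<parallel>x\<parallel>\<^sup>2)\<close>; dividing by \<open>\<alpha>\<close> and letting \<open>\<alpha> \<rightarrow> 0\<close> yields
  dissipativity with \<open>\<varsigma> = \<parallel>h(0)\<parallel>\<close>.
\<close>

section \<open>The Hahn-Banach theorem and the duality map\<close>

text \<open>The obstacle to solving the equation is boundedness. The Euler step has to beat a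
  Lipschitz error of order \<tau>^2, so it needs a bound for \<open>h\<close> on a slightly larger
  ball, and in infinite dimensions a holomorphic map may be unbounded on balls well inside its
  domain. A numerical range bound is weaker than a norm bound: its functionals are tied to the
  point, and the conversion used here presupposes some finite norm bound. Such a bound is available
  only near 0, by continuity. The conversion is therefore made on one small ball of radius s, degree
  by degree. The average starting at degree m has numerical range of order (s/\<theta>)^m there; the
  norm estimate drawn from it does not contain the a priori bound, and a Cauchy estimate on the
  circle of radius \<theta> s cancels s. What remains is the growth rate \<theta>^(-2m) for the
  coefficients of \<open>h\<close>, hence a bound on every ball of radius below \<theta>^2, and
  \<theta> may be chosen close to 1.\<close>

definition sublinear :: "('a::real_vector \<Rightarrow> real) \<Rightarrow> bool"
  where "sublinear p \<longleftrightarrow> (\<forall>x y. p (x + y) \<le> p x + p y) \<and> (\<forall>t>0. \<forall>x. p (t *\<^sub>R x) = t * p x)"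

lemma sublinear_0:
  assumes "sublinear p"
  shows "p 0 = 0"
proof -
  have "p (2 *\<^sub>R 0) = 2 * p 0" using assms unfolding sublinear_def by (metis zero_less_numeral)
  then show ?thesis by simp
qed

lemma sublinear_scaleR: "sublinear p \<Longrightarrow> t \<ge> 0 \<Longrightarrow> p (t *\<^sub>R x) = t * p x"
  using sublinear_0[of p] by (cases "t = 0") (auto simp: sublinear_def)

lemma sublinear_minus:
  assumes "sublinear p"
  shows "- p (- x) \<le> p x"
proof -
  have "p (x + (- x)) \<le> p x + p (- x)" using assms unfolding sublinear_def by blast
  then show ?thesis using sublinear_0[OF assms] by simp
qed

text \<open>For sublinear \<open>q\<close> this is the largest sublinear functional below
  \<open>q\<close> whose value at \<open>- x\<close> is at most \<open>- q x\<close>. It takes the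
  place of the one-dimensional extension step in the usual Hahn-Banach argument.\<close>

definition sublinear_shift :: "('a::real_vector \<Rightarrow> real) \<Rightarrow> 'a \<Rightarrow> 'a \<Rightarrow> real"
  where "sublinear_shift q x y = (INF t\<in>{0..}. q (y + t *\<^sub>R x) - t * q x)"

lemma sublinear_shift_bdd:
  assumes "sublinear q"
  shows "bdd_below ((\<lambda>t. q (y + t *\<^sub>R x) - t * q x) ` {0..})"
proof (rule bdd_belowI2)
  fix t :: real assume "t \<in> {0..}"
  have "q ((y + t *\<^sub>R x) + (- y)) \<le> q (y + t *\<^sub>R x) + q (- y)"
    using assms unfolding sublinear_def by blast
  then show "- q (- y) \<le> q (y + t *\<^sub>R x) - t * q x"
    using sublinear_scaleR[OF assms, of t x] \<open>t \<in> {0..}\<close> by simp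
qed

lemma sublinear_shift_le:
  assumes "sublinear q" "t \<ge> 0"
  shows "sublinear_shift q x y \<le> q (y + t *\<^sub>R x) - t * q x"
  unfolding sublinear_shift_def using assms by (intro cINF_lower sublinear_shift_bdd) auto

lemma sublinear_sublinear_shift:
  assumes q: "sublinear q"
  shows "sublinear (sublinear_shift q x)"
  unfolding sublinear_def
proof (intro conjI allI impI)
  fix y1 y2
  have step: "sublinear_shift q x (y1 + y2) - (q (y2 + t2 *\<^sub>R x) - t2 * q x) \<le> q (y1 + t1 *\<^sub>R x) - t1 * q x"
    if "t1 \<ge> 0" "t2 \<ge> 0" for t1 t2
  proof -
    have "sublinear_shift q x (y1 + y2) \<le> q (y1 + y2 + (t1 + t2) *\<^sub>R x) - (t1 + t2) * q x"
      using that by (intro sublinear_shift_le[OF q]) auto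
    also have "y1 + y2 + (t1 + t2) *\<^sub>R x = (y1 + t1 *\<^sub>R x) + (y2 + t2 *\<^sub>R x)"
      by (simp add: algebra_simps)
    also have "q \<dots> \<le> q (y1 + t1 *\<^sub>R x) + q (y2 + t2 *\<^sub>R x)"
      using q unfolding sublinear_def by blast
    finally show ?thesis by (simp add: algebra_simps)
  qed
  have "sublinear_shift q x (y1 + y2) - sublinear_shift q x y1 \<le> q (y2 + t2 *\<^sub>R x) - t2 * q x"
    if "t2 \<ge> 0" for t2
  proof -
    have "sublinear_shift q x (y1 + y2) - (q (y2 + t2 *\<^sub>R x) - t2 * q x) \<le> sublinear_shift q x y1"
      unfolding sublinear_shift_def[of q x y1] using step that by (intro cINF_greatest) auto
    then show ?thesis by simp
  qed
  then have "sublinear_shift q x (y1 + y2) - sublinear_shift q x y1 \<le> sublinear_shift q x y2"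
    unfolding sublinear_shift_def[of q x y2] by (intro cINF_greatest) auto
  then show "sublinear_shift q x (y1 + y2) \<le> sublinear_shift q x y1 + sublinear_shift q x y2"
    by simp
next
  \<comment> \<open>One inequality for all \<open>s\<close> and \<open>y\<close> suffices: the
    reverse one is its instance for \<open>1 / s\<close> and \<open>s *\<^sub>R y\<close>.\<close>
  have le: "s * sublinear_shift q x y \<le> sublinear_shift q x (s *\<^sub>R y)" if "s > 0" for s y
    unfolding sublinear_shift_def[of q x "s *\<^sub>R y"]
  proof (intro cINF_greatest)
    fix t :: real assume t: "t \<in> {0..}"
    have "sublinear_shift q x y \<le> q (y + (t / s) *\<^sub>R x) - (t / s) * q x"
      using that t by (intro sublinear_shift_le[OF q]) auto
    then have "s * sublinear_shift q x y \<le> s * q (y + (t / s) *\<^sub>R x) - t * q x"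
      using that by (simp add: field_simps)
    also have "s * q (y + (t / s) *\<^sub>R x) = q (s *\<^sub>R (y + (t / s) *\<^sub>R x))"
      using q that unfolding sublinear_def by simp
    also have "s *\<^sub>R (y + (t / s) *\<^sub>R x) = s *\<^sub>R y + t *\<^sub>R x"
      using that by (simp add: scaleR_add_right)
    finally show "s * sublinear_shift q x y \<le> q (s *\<^sub>R y + t *\<^sub>R x) - t * q x" .
  qed auto
  fix s :: real and y assume s: "s > 0"
  have "(1 / s) * sublinear_shift q x (s *\<^sub>R y) \<le> sublinear_shift q x y"
    using le[of "1 / s" "s *\<^sub>R y"] s by simp
  then show "sublinear_shift q x (s *\<^sub>R y) = s * sublinear_shift q x y"
    using le[OF s, of y] s by (simp add: field_simps)
qed

text \<open>Zorn's lemma applies because the pointwise infimum of a chain is again sublinear; it is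
  finite, since every sublinear functional below \<open>p\<close> is at least
  \<open>- p (- x)\<close> at \<open>x\<close>.\<close>

lemma exists_minimal_sublinear:
  fixes p :: "'a::real_vector \<Rightarrow> real"
  assumes p: "sublinear p"
  obtains q where "sublinear q" "q \<le> p" "\<And>r. sublinear r \<Longrightarrow> r \<le> q \<Longrightarrow> r = q"
proof -
  define A where "A = {q. sublinear q \<and> q \<le> p}"
  \<comment> \<open>The order is reversed, as Zorn's lemma yields maximal elements.\<close>
  define P :: "('a \<Rightarrow> real) \<Rightarrow> ('a \<Rightarrow> real) \<Rightarrow> bool" where "P = (\<lambda>a b. b \<le> a)"
  have "\<exists>m\<in>A. \<forall>a\<in>A. P m a \<longrightarrow> a = m"
  proof (rule predicate_Zorn)
    show "partial_order_on A (relation_of P A)"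
      by (rule partial_order_on_relation_ofI) (auto simp: P_def)
  next
    fix C assume C: "C \<in> Chains (relation_of P A)"
    show "\<exists>u\<in>A. \<forall>a\<in>C. P a u"
    proof (cases "C = {}")
      case True
      then show ?thesis using p by (auto simp: A_def)
    next
      case False
      have CA: "q \<in> A" if "q \<in> C" for q
        using C that by (auto simp: Chains_def relation_of_def)
      have lin: "q \<le> r \<or> r \<le> q" if "q \<in> C" "r \<in> C" for q r
        using C that by (auto simp: Chains_def relation_of_def P_def)
      define u where "u = (\<lambda>x. INF q\<in>C. q x)"
      have bdd: "bdd_below ((\<lambda>q. q x) ` C)" for x
      proof (rule bdd_belowI2)
        fix q assume "q \<in> C"
        then have "sublinear q" "q (- x) \<le> p (- x)" using CA by (auto simp: A_def le_fun_def)
        then show "- p (- x) \<le> q x" using sublinear_minus[of q x] by linarith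
      qed
      have u_le: "u x \<le> q x" if "q \<in> C" for q x
        unfolding u_def using bdd that by (rule cINF_lower)
      have ge_u: "b \<le> u x" if "\<And>q. q \<in> C \<Longrightarrow> b \<le> q x" for b x
        unfolding u_def using False that by (intro cINF_greatest) auto
      have "sublinear u"
        unfolding sublinear_def
      proof (intro conjI allI impI)
        fix x y
        \<comment> \<open>The infima at \<open>x\<close> and \<open>y\<close> may be approached by
          different members; in a chain the smaller of the two serves both.\<close>
        have step: "u (x + y) - r y \<le> q x" if qr: "q \<in> C" "r \<in> C" for q r
        proof -
          obtain s where s: "s \<in> C" "s \<le> q" "s \<le> r"
            using lin[OF qr] qr by blast
          have "u (x + y) \<le> s (x + y)" by (rule u_le[OF s(1)])
          also have "\<dots> \<le> s x + s y" using CA[OF s(1)] by (simp add: A_def sublinear_def)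
          also have "\<dots> \<le> q x + r y" using s by (intro add_mono) (auto simp: le_fun_def)
          finally show ?thesis by simp
        qed
        have "u (x + y) - r y \<le> u x" if "r \<in> C" for r
          using step that by (intro ge_u)
        then have "u (x + y) - u x \<le> u y"
          by (intro ge_u) (simp add: algebra_simps)
        then show "u (x + y) \<le> u x + u y" by simp
      next
        have le: "t * u x \<le> u (t *\<^sub>R x)" if "t > 0" for t x
        proof (rule ge_u)
          fix q assume "q \<in> C"
          then show "t * u x \<le> q (t *\<^sub>R x)"
            using CA[of q] u_le[of q x] that by (simp add: A_def sublinear_def)
        qed
        fix t :: real and x assume t: "t > 0"
        show "u (t *\<^sub>R x) = t * u x"
          using le[OF t, of x] le[of "1 / t" "t *\<^sub>R x"] t by (simp add: field_simps)
      qed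
      moreover have "u \<le> p"
        using False CA u_le unfolding A_def le_fun_def by (metis (mono_tags, lifting) ex_in_conv mem_Collect_eq order_trans)
      ultimately show ?thesis using u_le by (auto simp: A_def P_def le_fun_def)
    qed
  qed
  then obtain q where "q \<in> A" "\<And>a. a \<in> A \<Longrightarrow> a \<le> q \<Longrightarrow> a = q"
    by (auto simp: P_def)
  then show ?thesis
    using that[of q] by (auto simp: A_def intro: order_trans)
qed

text \<open>
  A minimal sublinear functional coincides with all its shifts, which forces additivity.
\<close>

lemma minimal_sublinear_linear:
  assumes q: "sublinear q" and min: "\<And>r. sublinear r \<Longrightarrow> r \<le> q \<Longrightarrow> r = q"
  shows "linear q"
proof -
  have "sublinear_shift q x = q" for x
  proof (rule min[OF sublinear_sublinear_shift[OF q]])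
    show "sublinear_shift q x \<le> q"
      using sublinear_shift_le[OF q, of 0 x] by (simp add: le_fun_def)
  qed
  \<comment> \<open>\<open>t = 1\<close> in the shift gives superadditivity, the missing half of
    additivity.\<close>
  then have "q y \<le> q (y + x) - q x" for x y
    using sublinear_shift_le[OF q, of 1 x y] by simp
  then have add: "q (x + y) = q x + q y" for x y
    using q unfolding sublinear_def by (metis add.commute le_diff_eq order_antisym)
  have minus: "q (- x) = - q x" for x
    using add[of x "- x"] sublinear_0[OF q] by simp
  have "q (t *\<^sub>R x) = t * q x" for t x
    using sublinear_scaleR[OF q, of t x] sublinear_scaleR[OF q, of "- t" x] minus[of "t *\<^sub>R x"]
    by (cases "t \<ge> 0") auto
  with add show ?thesis by (intro linearI) auto
qed

text \<open>Minimising below \<open>sublinear_shift norm x\<close> instead of below the norm builds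
  in the value at \<open>x\<close>: the shift is at most \<open>- norm x\<close> at
  \<open>- x\<close>, so a linear functional below it is at least \<open>norm x\<close> at
  \<open>x\<close>.\<close>

lemma real_norming_functional:
  fixes x :: "'a::real_normed_vector"
  obtains u :: "'a \<Rightarrow> real" where "linear u" "\<And>y. u y \<le> norm y" "u x = norm x"
proof -
  have n: "sublinear (norm :: 'a \<Rightarrow> real)"
    by (simp add: sublinear_def norm_triangle_ineq)
  obtain q where q: "sublinear q" "q \<le> sublinear_shift norm x" 
    and min: "\<And>r. sublinear r \<Longrightarrow> r \<le> q \<Longrightarrow> r = q"
    using exists_minimal_sublinear[OF sublinear_sublinear_shift[OF n, of x]] by metis
  have lin: "linear q" using minimal_sublinear_linear q min by blast
  have le: "q y \<le> norm y" for y
    using le_funD[OF q(2), of y] sublinear_shift_le[OF n, of 0 x y] by simp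
  have "q (- x) \<le> - norm x"
    using le_funD[OF q(2), of "- x"] sublinear_shift_le[OF n, of 1 x "- x"] by simp
  then have "q x = norm x"
    using le[of x] linear_neg[OF lin, of x] by simp
  then show ?thesis using that lin le by blast
qed

section \<open>Complex scalars, complex norming functionals and the duality map\<close>

lemma scaleC_minus_left: "(- c) *\<^sub>C x = - (c *\<^sub>C (x::'a::complex_normed_vector))"
  by (metis add.right_inverse add_eq_0_iff scaleC_add_left scaleR_scaleC scaleR_zero_left of_real_0)

lemma scaleC_one [simp]: "1 *\<^sub>C (x::'a::complex_normed_vector) = x"
  by (metis of_real_1 scaleR_one scaleR_scaleC)

lemma scaleC_zero_left [simp]: "0 *\<^sub>C (x::'a::complex_normed_vector) = 0"
  by (metis of_real_0 scaleR_zero_left scaleR_scaleC)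

lemma scaleC_zero_right [simp]: "c *\<^sub>C (0::'a::complex_normed_vector) = 0"
  by (metis add_cancel_right_right scaleC_add_right)

lemma scaleC_diff_right: "c *\<^sub>C (x - y) = c *\<^sub>C x - c *\<^sub>C (y::'a::complex_normed_vector)"
  by (metis add_diff_cancel diff_add_cancel scaleC_add_right)

lemma scaleC_scaleR_commute: "c *\<^sub>C r *\<^sub>R x = r *\<^sub>R c *\<^sub>C (x::'a::complex_normed_vector)"
  by (simp add: scaleR_scaleC scaleC_scaleC mult.commute)

lemma bounded_linear_scaleC_right: "bounded_linear (\<lambda>x::'a::complex_normed_vector. c *\<^sub>C x)"
  by (rule bounded_linear_intro[where K = "cmod c"])
     (auto simp: scaleC_add_right scaleC_scaleR_commute norm_scaleC)

lemma bounded_linear_scaleC_left: "bounded_linear (\<lambda>c. c *\<^sub>C (x::'a::complex_normed_vector))"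
  by (rule bounded_linear_intro[where K = "norm x"])
     (auto simp: scaleC_add_left scaleR_scaleC norm_scaleC scaleC_scaleC scaleR_conv_of_real scaleC_complex_def)

lemma complex_norming_functional:
  fixes x :: "'a::complex_normed_vector"
  obtains l where "l \<in> cdual" "\<And>y. cmod (l y) \<le> norm y" "l x = complex_of_real (norm x)"
proof -
  obtain u :: "'a \<Rightarrow> real" where u: "linear u" "\<And>y. u y \<le> norm y" "u x = norm x"
    using real_norming_functional by blast
  \<comment> \<open>Complex linearity forces this imaginary part once the real part is
    \<open>u\<close>.\<close>
  define l where "l y = Complex (u y) (- u (\<i> *\<^sub>C y))" for y
  have ladd: "l (y + z) = l y + l z" for y z
    by (simp add: l_def complex_eq_iff scaleC_add_right linear_add[OF u(1)])
  have lR: "l (r *\<^sub>R y) = r *\<^sub>R l y" for r y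
    by (simp add: l_def complex_eq_iff scaleC_scaleR_commute linear_scale[OF u(1)])
  have li: "l (\<i> *\<^sub>C y) = \<i> * l y" for y
    by (simp add: l_def complex_eq_iff scaleC_scaleC scaleC_minus_left linear_neg[OF u(1)])
  have lC: "l (c *\<^sub>C y) = c * l y" for c y
  proof -
    have "c *\<^sub>C y = Re c *\<^sub>R y + Im c *\<^sub>R \<i> *\<^sub>C y"
      by (subst (1) complex_eq) (simp add: scaleC_add_left scaleR_scaleC scaleC_scaleC mult.commute)
    then have "l (c *\<^sub>C y) = Re c *\<^sub>R l y + Im c *\<^sub>R (\<i> * l y)"
      by (simp only: ladd lR li)
    also have "\<dots> = c * l y"
      by (subst (3) complex_eq) (simp add: scaleR_conv_of_real algebra_simps)
    finally show ?thesis .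
  qed
  have bound: "cmod (l y) \<le> norm y" for y
  proof (cases "l y = 0")
    case False
    \<comment> \<open>Rotating \<open>y\<close> by a unimodular number makes the value real and
      nonnegative, so the bound for \<open>u\<close> becomes a bound for the modulus.\<close>
    define c where "c = cnj (l y) / cmod (l y)"
    have "c * l y = cmod (l y)"
      using False by (simp add: c_def complex_norm_square[symmetric] power2_eq_square mult.commute)
    then have "cmod (l y) = Re (l (c *\<^sub>C y))" by (simp add: lC)
    also have "\<dots> \<le> norm (c *\<^sub>C y)" using u(2) by (simp add: l_def)
    also have "\<dots> = norm y" using False by (simp add: norm_scaleC c_def norm_divide)
    finally show ?thesis .
  qed auto
  have "bounded_linear l"
    by (rule bounded_linear_intro[where K = 1]) (auto simp: ladd lR bound)
  then have "l \<in> cdual"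
    by (simp add: cdual_def bounded_clinear_def lC scaleC_complex_def)
  moreover have "l x = complex_of_real (norm x)"
  proof -
    have "Re (l x) = norm x" by (simp add: l_def u)
    then show ?thesis using bound[of x] cmod_power2[of "l x"]
      by (smt (verit) complex_eq_iff Im_complex_of_real Re_complex_of_real norm_ge_zero power_mono sum_power2_eq_zero_iff zero_le_power2 zero_eq_power2)
  qed
  ultimately show ?thesis using that bound by blast
qed

lemma cdualD:
  assumes "f \<in> cdual"
  shows "bounded_linear f" "f (c *\<^sub>C x) = c * f x" "f (x + y) = f x + f y" "f (x - y) = f x - f y"
    "f 0 = 0" "f (r *\<^sub>R x) = of_real r * f x"
  using assms unfolding cdual_def bounded_clinear_def scaleC_complex_def
  by (auto simp: bounded_linear.linear linear_add linear_diff linear_0 linear_scale scaleR_conv_of_real)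

text \<open>Once the value at \<open>x\<close> is prescribed, the lower bound for the dual norm is
  automatic, so the condition on \<open>onorm\<close> reduces to an upper estimate. All later
  arguments use the duality map in this form.\<close>

lemma duality_map_iff:
  "f \<in> duality_map x \<longleftrightarrow>
    f \<in> cdual \<and> (\<forall>y. cmod (f y) \<le> norm x * norm y) \<and> f x = complex_of_real ((norm x)\<^sup>2)"
proof (cases "f \<in> cdual \<and> f x = complex_of_real ((norm x)\<^sup>2)")
  case True
  then have f: "f \<in> cdual" "f x = complex_of_real ((norm x)\<^sup>2)" by auto
  have "(norm x)\<^sup>2 = (onorm f)\<^sup>2 \<longleftrightarrow> (\<forall>y. cmod (f y) \<le> norm x * norm y)" (is "?L \<longleftrightarrow> ?R")
  proof
    assume ?L
    then have "onorm f = norm x"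
      using onorm_pos_le[OF cdualD(1)[OF f(1)]] by (metis norm_ge_zero power2_eq_imp_eq)
    then show ?R using onorm[OF cdualD(1)[OF f(1)]] by metis
  next
    assume R: ?R
    then have "onorm f \<le> norm x" by (intro onorm_bound) auto
    moreover have "norm x \<le> onorm f"
    proof (cases "x = 0")
      case False
      have "cmod (f x) \<le> onorm f * norm x" by (rule onorm[OF cdualD(1)[OF f(1)]])
      then show ?thesis using f(2) False by (simp add: power2_eq_square norm_mult)
    qed (simp add: onorm_pos_le[OF cdualD(1)[OF f(1)]])
    ultimately show ?L by simp
  qed
  then show ?thesis using f unfolding duality_map_def
    by (simp del: of_real_power)
qed (auto simp: duality_map_def)

lemma duality_map_nonempty: "\<exists>f. f \<in> duality_map (x::'a::complex_normed_vector)"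
proof -
  obtain l where l: "l \<in> cdual" "\<And>y. cmod (l y) \<le> norm y" "l x = complex_of_real (norm x)"
    using complex_norming_functional by blast
  have "(\<lambda>y. norm x * l y) \<in> duality_map x"
    unfolding duality_map_iff
  proof (intro conjI allI)
    show "(\<lambda>y. norm x * l y) \<in> cdual"
      using l(1) unfolding cdual_def bounded_clinear_def scaleC_complex_def
      by (auto simp: bounded_linear_const_mult)
  qed (auto simp: l norm_mult power2_eq_square intro!: mult_left_mono)
  then show ?thesis by blast
qed

section \<open>Holomorphic maps between complex normed spaces\<close>

instance complex_banach \<subseteq> banach ..

section \<open>Closure properties of \<open>Hol\<close>\<close>

lemma bounded_clinear_compose:
  "bounded_clinear f \<Longrightarrow> bounded_clinear g \<Longrightarrow> bounded_clinear (\<lambda>x. g (f x))"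
  unfolding bounded_clinear_def by (auto intro: bounded_linear_compose)

lemma bounded_clinear_add:
  "bounded_clinear f \<Longrightarrow> bounded_clinear g \<Longrightarrow> bounded_clinear (\<lambda>x. f x + g x)"
  unfolding bounded_clinear_def by (auto intro: bounded_linear_add simp: scaleC_add_right)

lemma bounded_clinear_scaleC: "bounded_clinear (\<lambda>x. c *\<^sub>C x)"
  unfolding bounded_clinear_def
  by (auto simp: bounded_linear_scaleC_right scaleC_scaleC mult.commute)

lemma HolE:
  assumes "f \<in> Hol D W" "x \<in> D"
  obtains f' where "bounded_clinear f'" "(f has_derivative f') (at x)"
  using assms unfolding Hol_def by blast

lemma Hol_mem: "f \<in> Hol D W \<Longrightarrow> x \<in> D \<Longrightarrow> f x \<in> W"
  unfolding Hol_def by blast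

lemma Hol_mono: "f \<in> Hol D W \<Longrightarrow> D' \<subseteq> D \<Longrightarrow> (\<And>x. x \<in> D' \<Longrightarrow> f x \<in> W') \<Longrightarrow> f \<in> Hol D' W'"
  unfolding Hol_def by blast

lemma Hol_UNIV: "f \<in> Hol D W \<Longrightarrow> f \<in> Hol D UNIV"
  by (rule Hol_mono) auto

lemma Hol_continuous: "f \<in> Hol D W \<Longrightarrow> x \<in> D \<Longrightarrow> isCont f x"
  by (metis HolE has_derivative_continuous)

lemma Hol_compose:
  assumes f: "f \<in> Hol D W" and g: "g \<in> Hol W V"
  shows "(\<lambda>x. g (f x)) \<in> Hol D V"
  unfolding Hol_def
proof safe
  fix x assume x: "x \<in> D"
  then show "g (f x) \<in> V" using assms by (auto simp: Hol_def)
  obtain f' where f': "bounded_clinear f'" "(f has_derivative f') (at x)"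
    using HolE[OF f x] .
  obtain g' where g': "bounded_clinear g'" "(g has_derivative g') (at (f x))"
    using HolE[OF g Hol_mem[OF f x]] .
  show "\<exists>h'. bounded_clinear h' \<and> ((\<lambda>x. g (f x)) has_derivative h') (at x)"
    using bounded_clinear_compose[OF f'(1) g'(1)] has_derivative_compose[OF f'(2) g'(2)] by blast
qed

lemma Hol_bounded_clinear: "bounded_clinear f \<Longrightarrow> f \<in> Hol D UNIV"
  unfolding Hol_def bounded_clinear_def by (auto intro: bounded_linear_imp_has_derivative)

lemma Hol_const: "c \<in> W \<Longrightarrow> (\<lambda>x. c) \<in> Hol D W"
  unfolding Hol_def bounded_clinear_def
  by (auto intro!: exI[of _ "\<lambda>x. 0"] bounded_linear_zero)

lemma Hol_ident: "(\<lambda>x. x) \<in> Hol D D"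
  unfolding Hol_def bounded_clinear_def
  by (auto intro!: exI[of _ "\<lambda>x. x"] bounded_linear_ident)

lemma Hol_add:
  assumes f: "f \<in> Hol D V" and g: "g \<in> Hol D W"
  shows "(\<lambda>x. f x + g x) \<in> Hol D UNIV"
  unfolding Hol_def
proof safe
  fix x assume x: "x \<in> D"
  obtain f' where f': "bounded_clinear f'" "(f has_derivative f') (at x)"
    using HolE[OF f x] .
  obtain g' where g': "bounded_clinear g'" "(g has_derivative g') (at x)"
    using HolE[OF g x] .
  show "\<exists>h'. bounded_clinear h' \<and> ((\<lambda>x. f x + g x) has_derivative h') (at x)"
    using bounded_clinear_add[OF f'(1) g'(1)] has_derivative_add[OF f'(2) g'(2)] by blast
qed simp

lemma bounded_bilinear_scaleC: "bounded_bilinear (\<lambda>c x::'a::complex_normed_vector. c *\<^sub>C x)"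
  by (rule bounded_bilinear.intro)
     (auto simp: scaleC_add_left scaleC_add_right scaleR_scaleC scaleC_scaleC scaleC_complex_def
        norm_scaleC mult.commute intro!: exI[of _ 1])

lemma Hol_scaleC:
  fixes c :: "'d::complex_normed_vector \<Rightarrow> complex" and f :: "'d \<Rightarrow> 'a::complex_normed_vector"
  assumes c: "c \<in> Hol D V" and f: "f \<in> Hol D W"
  shows "(\<lambda>x. c x *\<^sub>C f x) \<in> Hol D UNIV"
  unfolding Hol_def
proof safe
  fix x assume x: "x \<in> D"
  obtain c' where c': "bounded_clinear c'" "(c has_derivative c') (at x)"
    using HolE[OF c x] .
  obtain f' where f': "bounded_clinear f'" "(f has_derivative f') (at x)"
    using HolE[OF f x] .
  have "((\<lambda>x. c x *\<^sub>C f x) has_derivative (\<lambda>h. c x *\<^sub>C f' h + c' h *\<^sub>C f x)) (at x)"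
    by (rule bounded_bilinear.FDERIV[OF bounded_bilinear_scaleC c'(2) f'(2)])
  moreover from this have "bounded_clinear (\<lambda>h. c x *\<^sub>C f' h + c' h *\<^sub>C f x)"
    using c'(1) f'(1) has_derivative_bounded_linear unfolding bounded_clinear_def
    by (auto simp: scaleC_complex_def scaleC_add_right scaleC_scaleC mult.commute)
  ultimately show "\<exists>h'. bounded_clinear h' \<and> ((\<lambda>x. c x *\<^sub>C f x) has_derivative h') (at x)"
    by blast
qed simp

lemma Hol_cmult: "f \<in> Hol D W \<Longrightarrow> (\<lambda>x. c *\<^sub>C f x) \<in> Hol D UNIV"
  by (rule Hol_scaleC[OF Hol_const]) auto

lemma Hol_scaleR: "f \<in> Hol D W \<Longrightarrow> (\<lambda>x. r *\<^sub>R f x) \<in> Hol D UNIV"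
  unfolding scaleR_scaleC by (rule Hol_cmult)

lemma Hol_diff:
  assumes "f \<in> Hol D V" "g \<in> Hol D W"
  shows "(\<lambda>x. f x - g x) \<in> Hol D UNIV"
  using Hol_add[OF assms(1) Hol_scaleR[OF assms(2), of "-1"]] by simp

lemma Hol_sum:
  assumes "finite I" "\<And>i. i \<in> I \<Longrightarrow> f i \<in> Hol D UNIV"
  shows "(\<lambda>x. \<Sum>i\<in>I. f i x) \<in> Hol D UNIV"
  using assms
proof (induction rule: finite_induct)
  case (insert i I)
  then show ?case using Hol_add[of "f i" D UNIV "\<lambda>x. \<Sum>i\<in>I. f i x" UNIV] by simp
qed (auto intro: Hol_const)

text \<open>Openness is essential: \<open>Hol\<close> takes the derivative at \<open>x\<close>
  without restriction to the domain.\<close>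

lemma Hol_cong:
  assumes f: "f \<in> Hol D W" and D: "open D" and eq: "\<And>x. x \<in> D \<Longrightarrow> g x = f x"
  shows "g \<in> Hol D W"
  unfolding Hol_def
proof safe
  fix x assume x: "x \<in> D"
  then show "g x \<in> W" using Hol_mem[OF f x] eq by simp
  obtain f' where f': "bounded_clinear f'" "(f has_derivative f') (at x)"
    using HolE[OF f x] .
  have "(g has_derivative f') (at x)"
    using has_derivative_transform_within_open[OF f'(2) D x] eq by metis
  with f' show "\<exists>h'. bounded_clinear h' \<and> (g has_derivative h') (at x)" by blast
qed

section \<open>Complex lines, Cauchy estimates and uniform limits\<close>

lemma Hol_line: "(\<lambda>\<zeta>. a + \<zeta> *\<^sub>C v) \<in> Hol D UNIV"
  by (rule Hol_add[OF Hol_const[OF UNIV_I] Hol_scaleC[OF Hol_ident Hol_const[OF UNIV_I]]])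

lemma Hol_imp_holomorphic:
  fixes f :: "complex \<Rightarrow> complex"
  assumes "f \<in> Hol D W"
  shows "f holomorphic_on D"
proof (rule holomorphic_onI)
  fix x assume "x \<in> D"
  then obtain f' where f': "bounded_clinear f'" "(f has_derivative f') (at x)"
    using HolE[OF assms] by blast
  have "f' = (*) (f' 1)"
  proof
    fix c show "f' c = f' 1 * c"
      using f'(1) unfolding bounded_clinear_def scaleC_complex_def
      by (metis mult.commute mult.right_neutral)
  qed
  then have "(f has_field_derivative f' 1) (at x)"
    using f'(2) by (simp add: has_field_derivative_def)
  then show "f field_differentiable at x within D"
    using field_differentiable_at_within field_differentiable_def by blast
qed

lemma cdual_Hol_line_holomorphic:
  assumes F: "F \<in> Hol U W" and l: "l \<in> cdual" and D: "\<And>\<zeta>. \<zeta> \<in> D \<Longrightarrow> a + \<zeta> *\<^sub>C v \<in> U"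
  shows "(\<lambda>\<zeta>. l (F (a + \<zeta> *\<^sub>C v))) holomorphic_on D"
proof (rule Hol_imp_holomorphic)
  have "(\<lambda>\<zeta>. a + \<zeta> *\<^sub>C v) \<in> Hol D U"
    using Hol_mono[OF Hol_line] D by blast
  then have "(\<lambda>\<zeta>. F (a + \<zeta> *\<^sub>C v)) \<in> Hol D UNIV"
    using Hol_compose[OF _ Hol_UNIV[OF F]] by blast
  then show "(\<lambda>\<zeta>. l (F (a + \<zeta> *\<^sub>C v))) \<in> Hol D UNIV"
    using Hol_compose[OF _ Hol_bounded_clinear] l unfolding cdual_def by blast
qed

lemma Hol_has_derivative_clinear:
  assumes "F \<in> Hol U W" "a \<in> U" "(F has_derivative F') (at a)"
  shows "bounded_clinear F'"
  using HolE[OF assms(1,2)] has_derivative_unique assms(3) by metis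

lemma cdual_Hol_line_deriv:
  assumes F: "F \<in> Hol U W" "a \<in> U" and der: "(F has_derivative F') (at a)" and l: "l \<in> cdual"
  shows "((\<lambda>\<zeta>. l (F (a + \<zeta> *\<^sub>C v))) has_field_derivative l (F' v)) (at 0)"
proof -
  have "((\<lambda>\<zeta>. a + \<zeta> *\<^sub>C v) has_derivative (\<lambda>\<zeta>. \<zeta> *\<^sub>C v)) (at 0)"
    by (rule has_derivative_eq_rhs[OF has_derivative_add[OF has_derivative_const
          bounded_linear_imp_has_derivative[OF bounded_linear_scaleC_left]]]) simp
  then have "((\<lambda>\<zeta>. F (a + \<zeta> *\<^sub>C v)) has_derivative (\<lambda>\<zeta>. F' (\<zeta> *\<^sub>C v))) (at 0)"
    by (rule has_derivative_compose) (simp add: der)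
  then have "((\<lambda>\<zeta>. l (F (a + \<zeta> *\<^sub>C v))) has_derivative (\<lambda>\<zeta>. l (F' (\<zeta> *\<^sub>C v)))) (at 0)"
    by (rule bounded_linear.has_derivative[OF cdualD(1)[OF l]])
  moreover have "(\<lambda>\<zeta>. l (F' (\<zeta> *\<^sub>C v))) = (*) (l (F' v))"
    using Hol_has_derivative_clinear[OF F der]
    by (auto simp: bounded_clinear_def cdualD[OF l] mult.commute)
  ultimately show ?thesis by (simp add: has_field_derivative_def)
qed

lemma ball_subset_ball_dist:
  fixes a :: "'a::metric_space"
  assumes "dist a z + s \<le> r"
  shows "ball z s \<subseteq> ball a r"
proof
  fix x assume "x \<in> ball z s"
  then show "x \<in> ball a r" using assms dist_triangle[of a x z] by simp
qed

text \<open>With \<open>l\<close> norming \<open>F' v\<close>, this is the scalar Cauchy inequality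
  for \<open>l\<close> composed with \<open>F\<close> along the line through \<open>a\<close> in
  direction \<open>v\<close>, which stays in the ball for parameters of modulus below
  \<open>r / norm v\<close>.\<close>

lemma Hol_derivative_bound:
  fixes F :: "'a::complex_normed_vector \<Rightarrow> 'b::complex_normed_vector"
  assumes F: "F \<in> Hol (ball a r) UNIV" and r: "r > 0"
    and M: "\<And>x. x \<in> ball a r \<Longrightarrow> norm (F x) \<le> M"
    and der: "(F has_derivative F') (at a)"
  shows "norm (F' v) \<le> M / r * norm v"
proof (cases "v = 0")
  case True
  then show ?thesis
    using has_derivative_bounded_linear[OF der] by (simp add: bounded_linear.linear linear_0)
next
  case False
  obtain l where l: "l \<in> cdual" "\<And>y. cmod (l y) \<le> norm y" "l (F' v) = complex_of_real (norm (F' v))"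
    using complex_norming_functional by blast
  define R where "R = r / norm v"
  have R: "R > 0" using r False by (simp add: R_def)
  define u where "u \<zeta> = l (F (a + \<zeta> *\<^sub>C v))" for \<zeta>
  have mem: "a + \<zeta> *\<^sub>C v \<in> ball a r" if "cmod \<zeta> < R" for \<zeta>
    using that False by (simp add: dist_norm norm_scaleC R_def field_simps)
  have hol: "u holomorphic_on ball 0 R"
    unfolding u_def by (rule cdual_Hol_line_holomorphic[OF F l(1)]) (use mem in auto)
  have bound: "cmod (u \<zeta>) \<le> M" if "cmod \<zeta> < R" for \<zeta>
    unfolding u_def using l(2) M[OF mem[OF that]] order_trans by blast
  have du: "deriv u 0 = l (F' v)"
    unfolding u_def by (rule DERIV_imp_deriv[OF cdual_Hol_line_deriv[OF F _ der l(1)]]) (use r in simp)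
  \<comment> \<open>The scalar inequality wants continuity up to the circle, hence radii
    \<open>s < R\<close> first and the passage to \<open>R\<close> afterwards.\<close>
  have "norm (F' v) * s \<le> M" if s: "0 < s" "s < R" for s
  proof -
    have "cmod ((deriv ^^ 1) u 0) \<le> fact 1 * M / s ^ 1"
    proof (rule Cauchy_inequality)
      show "u holomorphic_on ball 0 s" using hol by (rule holomorphic_on_subset) (use s in auto)
      show "continuous_on (cball 0 s) u"
        by (rule continuous_on_subset[OF holomorphic_on_imp_continuous_on[OF hol]]) (use s in auto)
    qed (use s bound in auto)
    then show ?thesis using s du l(3) by (simp add: field_simps)
  qed
  then have "norm (F' v) * R \<le> M"
  proof (cases "F' v = 0")
    case True
    then show ?thesis using bound[of 0] R order_trans[OF norm_ge_zero] by auto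
  next
    case nz: False
    have "R \<le> M / norm (F' v)"
    proof (rule dense_le_bounded[OF R])
      fix s assume "0 < s" "s < R"
      then have "norm (F' v) * s \<le> M" by fact
      then show "s \<le> M / norm (F' v)" using nz by (simp add: field_simps)
    qed
    then show ?thesis using nz by (simp add: field_simps)
  qed
  then show ?thesis using r False by (simp add: R_def field_simps)
qed

text \<open>Each point of the inner ball carries a ball of radius \<open>r - s\<close> inside the
  outer one, so the Cauchy estimate bounds the derivative there by \<open>M / (r - s)\<close>;
  convexity does the rest.\<close>

lemma Hol_Lipschitz:
  fixes F :: "'a::complex_normed_vector \<Rightarrow> 'b::complex_normed_vector"
  assumes F: "F \<in> Hol (ball a r) UNIV" and s: "s < r"
    and M: "\<And>x. x \<in> ball a r \<Longrightarrow> norm (F x) \<le> M"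
    and x: "x \<in> cball a s" and y: "y \<in> cball a s"
  shows "norm (F x - F y) \<le> M / (r - s) * norm (x - y)"
proof -
  have "\<exists>F'. (F has_derivative F') (at z)" if "z \<in> cball a s" for z
    using HolE[OF F, of z] that s by (metis mem_ball mem_cball order_le_less_trans)
  then obtain F' where F': "\<And>z. z \<in> cball a s \<Longrightarrow> (F has_derivative F' z) (at z)"
    by metis
  show ?thesis
  proof (rule differentiable_bound[OF convex_cball has_derivative_at_withinI[OF F'] _ x y])
    fix z assume z: "z \<in> cball a s"
    have sub: "ball z (r - s) \<subseteq> ball a r"
      using z by (intro ball_subset_ball_dist) auto 
    have "norm (F' z v) \<le> M / (r - s) * norm v" for v
    proof (rule Hol_derivative_bound[OF _ _ _ F'[OF z]])
      show "F \<in> Hol (ball z (r - s)) UNIV" using Hol_mono[OF F sub] by auto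
    qed (use s sub M in auto)
    moreover have "0 \<le> M"
      using M[of z] z s order_trans[OF norm_ge_zero] by auto
    ultimately show "onorm (F' z) \<le> M / (r - s)"
      using s by (intro onorm_bound) auto
  qed
qed

text \<open>Cauchy estimates for the differences \<open>f n - f m\<close> make the derivatives
  locally uniformly Cauchy, so the real theorem on differentiating a sequence applies; complex
  homogeneity of the derivative survives the pointwise limit.\<close>

lemma Hol_uniform_limit:
  fixes f :: "nat \<Rightarrow> 'e::complex_normed_vector \<Rightarrow> 'b::complex_banach"
  assumes L: "open L" and f: "\<And>n. f n \<in> Hol L UNIV" and lim: "uniform_limit L f g sequentially"
  shows "g \<in> Hol L UNIV"
  unfolding Hol_def
proof safe
  fix x0 assume x0: "x0 \<in> L"
  obtain d' where d': "d' > 0" "ball x0 d' \<subseteq> L" using L x0 open_contains_ball by blast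
  \<comment> \<open>Halving leaves room for a Cauchy estimate of radius \<open>d\<close> at every
    point of \<open>ball x0 d\<close>.\<close>
  define d where "d = d' / 2"
  have d: "d > 0" using d' by (simp add: d_def)
  have sub: "ball x d \<subseteq> L" if "x \<in> ball x0 d" for x
  proof -
    have "ball x d \<subseteq> ball x0 d'"
      using that by (intro ball_subset_ball_dist) (auto simp: d_def)
    then show ?thesis using d' by blast
  qed
  have "\<forall>n x. \<exists>f'. x \<in> L \<longrightarrow> bounded_clinear f' \<and> (f n has_derivative f') (at x)"
    using HolE[OF f] by metis
  then obtain f' where f': "\<And>n x. x \<in> L \<Longrightarrow> bounded_clinear (f' n x)"
    "\<And>n x. x \<in> L \<Longrightarrow> (f n has_derivative f' n x) (at x)" by metis
  have SL: "x \<in> L" if "x \<in> ball x0 d" for x using sub[OF that] d by auto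
  have cauchy: "\<exists>N. \<forall>n\<ge>N. \<forall>m\<ge>N. \<forall>x\<in>ball x0 d. \<forall>h. norm (f' n x h - f' m x h) \<le> e * norm h"
    if e: "e > 0" for e
  proof -
    have "uniformly_Cauchy_on L f" using lim uniformly_convergent_Cauchy uniformly_convergent_on_def by blast
    then obtain N where N: "\<And>x m n. x \<in> L \<Longrightarrow> m \<ge> N \<Longrightarrow> n \<ge> N \<Longrightarrow> dist (f m x) (f n x) < e * d"
      using e d unfolding uniformly_Cauchy_on_def by (metis mult_pos_pos)
    have "norm (f' n x h - f' m x h) \<le> e * norm h" if "n \<ge> N" "m \<ge> N" "x \<in> ball x0 d" for n m x h
    proof -
      have "norm (f' n x h - f' m x h) \<le> (e * d) / d * norm h"
      proof (rule Hol_derivative_bound)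
        show "(\<lambda>x. f n x - f m x) \<in> Hol (ball x d) UNIV"
          using Hol_mono[OF Hol_diff[OF f[of n] f[of m]] sub[OF that(3)]] by simp
        show "((\<lambda>x. f n x - f m x) has_derivative (\<lambda>h. f' n x h - f' m x h)) (at x)"
          by (intro has_derivative_diff f' SL that)
        fix y assume "y \<in> ball x d"
        then show "norm (f n y - f m y) \<le> e * d"
          using N[of y n m] sub[OF that(3)] that by (auto simp: dist_norm intro: less_imp_le)
      qed (use d in auto)
      then show ?thesis using d by simp
    qed
    then show ?thesis by blast
  qed
  define g' where "g' x h = lim (\<lambda>n. f' n x h)" for x h
  have conv: "(\<lambda>n. f' n x h) \<longlonglongrightarrow> g' x h" if x: "x \<in> ball x0 d" for x h
  proof -
    have "Cauchy (\<lambda>n. f' n x h)"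
    proof (rule CauchyI)
      fix e :: real assume e: "e > 0"
      define e' where "e' = e / (norm h + 1)"
      have pos: "norm h + 1 > 0" by (smt (verit) norm_ge_zero)
      then have e': "e' > 0" "e' * norm h < e"
        using e by (auto simp: e'_def divide_simps) 
      obtain N where N: "\<And>n m x h. n \<ge> N \<Longrightarrow> m \<ge> N \<Longrightarrow> x \<in> ball x0 d \<Longrightarrow> norm (f' n x h - f' m x h) \<le> e' * norm h"
        using cauchy[OF e'(1)] by metis
      then show "\<exists>M. \<forall>m\<ge>M. \<forall>n\<ge>M. norm (f' m x h - f' n x h) < e"
        using x e'(2) by (meson order_le_less_trans)
    qed
    then show ?thesis unfolding g'_def by (rule convergent_LIMSEQ_iff[THEN iffD1, OF Cauchy_convergent])
  qed
  have "\<exists>g0. \<forall>x\<in>ball x0 d. (\<lambda>n. f n x) \<longlonglongrightarrow> g0 x \<and> (g0 has_derivative g' x) (at x within ball x0 d)"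
  proof (rule has_derivative_sequence[OF convex_ball])
    show "x0 \<in> ball x0 d" using d by simp
    show "(\<lambda>n. f n x0) \<longlonglongrightarrow> g x0" using lim x0 by (rule tendsto_uniform_limitI)
    show "(f n has_derivative f' n x) (at x within ball x0 d)" if "x \<in> ball x0 d" for n x
      by (rule has_derivative_at_withinI[OF f'(2)[OF SL[OF that]]])
    fix e :: real assume "e > 0"
    then obtain N where N: "\<And>n m x h. n \<ge> N \<Longrightarrow> m \<ge> N \<Longrightarrow> x \<in> ball x0 d \<Longrightarrow> norm (f' n x h - f' m x h) \<le> e * norm h"
      using cauchy by metis
    have "norm (f' n x h - g' x h) \<le> e * norm h" if "n \<ge> N" "x \<in> ball x0 d" for n x h
    proof (rule tendsto_upperbound)
      show "(\<lambda>m. norm (f' n x h - f' m x h)) \<longlonglongrightarrow> norm (f' n x h - g' x h)"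
        by (intro tendsto_intros conv that)
      show "\<forall>\<^sub>F m in sequentially. norm (f' n x h - f' m x h) \<le> e * norm h"
        using N that unfolding eventually_sequentially by blast
    qed simp
    then show "\<forall>\<^sub>F n in sequentially. \<forall>x\<in>ball x0 d. \<forall>h. norm (f' n x h - g' x h) \<le> e * norm h"
      unfolding eventually_sequentially by blast
  qed
  then obtain g0 where g0: "\<And>x. x \<in> ball x0 d \<Longrightarrow> (\<lambda>n. f n x) \<longlonglongrightarrow> g0 x"
    "\<And>x. x \<in> ball x0 d \<Longrightarrow> (g0 has_derivative g' x) (at x within ball x0 d)" by metis
  have g0_eq: "g0 x = g x" if "x \<in> ball x0 d" for x
    using g0(1)[OF that] tendsto_uniform_limitI[OF lim SL[OF that]] LIMSEQ_unique by blast
  have "(g0 has_derivative g' x0) (at x0)"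
    using g0(2)[of x0] d by (simp add: at_within_open[OF _ open_ball])
  then have der: "(g has_derivative g' x0) (at x0)"
    by (rule has_derivative_transform_within_open[OF _ open_ball[of x0 d]]) (use g0_eq d in auto)
  have "g' x0 (c *\<^sub>C h) = c *\<^sub>C g' x0 h" for c h
  proof -
    have "(\<lambda>n. c *\<^sub>C f' n x0 h) \<longlonglongrightarrow> c *\<^sub>C g' x0 h"
      using conv d by (intro bounded_linear.tendsto[OF bounded_linear_scaleC_right]) auto
    moreover have "f' n x0 (c *\<^sub>C h) = c *\<^sub>C f' n x0 h" for n
      using f'(1)[OF x0] by (simp add: bounded_clinear_def)
    ultimately show ?thesis
      using LIMSEQ_unique conv[of x0 "c *\<^sub>C h"] d by simp
  qed
  with der show "\<exists>g'. bounded_clinear g' \<and> (g has_derivative g') (at x0)"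
    using has_derivative_bounded_linear unfolding bounded_clinear_def by blast
qed simp

section \<open>The Earle-Hamilton theorem on balls\<close>

text \<open>A Riemann map followed by a Moebius map sends \<open>a\<close> to 0 and \<open>b\<close>
  to some \<beta>, and the Schwarz lemma gives \<open>k = cmod \<beta>\<close>. The factor is fixed
  before \<open>u\<close> and \<open>R\<close>, so it depends on the domain and the two points
  only.\<close>

lemma convex_domain_contraction:
  fixes U :: "complex set"
  assumes U: "open U" "convex U" "U \<noteq> UNIV" and a: "a \<in> U" and b: "b \<in> U"
  obtains k where "0 \<le> k" "k < 1"
    "\<And>u R. u holomorphic_on U \<Longrightarrow> (\<And>\<zeta>. \<zeta> \<in> U \<Longrightarrow> cmod (u \<zeta> - u a) \<le> R) \<Longrightarrow> cmod (u b - u a) \<le> k * R"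
proof -
  have "simply_connected U" using U convex_imp_simply_connected by blast
  then obtain f g where fg: "f holomorphic_on U" "g holomorphic_on ball 0 1"
    "\<And>z. z \<in> U \<Longrightarrow> f z \<in> ball 0 1" "\<And>z. z \<in> U \<Longrightarrow> g (f z) = z"
    "\<And>z. z \<in> ball 0 1 \<Longrightarrow> g z \<in> U"
    using Riemann_mapping_theorem[of U] U a by (smt (verit) empty_iff)
  define \<beta> where "\<beta> = Moebius_function 0 (f a) (f b)"
  define G where "G w = g (Moebius_function 0 (- f a) w)" for w
  have fa: "cmod (f a) < 1" "cmod (f b) < 1" using fg(3) a b by auto
  have \<beta>: "cmod \<beta> < 1" unfolding \<beta>_def using Moebius_function_norm_lt_1 fa by blast
  have M: "Moebius_function 0 (- f a) w \<in> ball 0 1" if "cmod w < 1" for w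
    using Moebius_function_norm_lt_1[of "- f a" w] that fa by simp
  have G0: "G 0 = a"
    by (simp add: G_def Moebius_function_of_zero fg a)
  have Gb: "G \<beta> = b"
    unfolding G_def \<beta>_def using Moebius_function_compose[of "- f a" "f a" "f b"] fa fg(4)[OF b] by simp
  have Ghol: "G holomorphic_on ball 0 1"
  proof -
    have "Moebius_function 0 (- f a) holomorphic_on ball 0 1"
      using Moebius_function_holomorphic[of "- f a"] fa by simp
    moreover have "Moebius_function 0 (- f a) ` ball 0 1 \<subseteq> ball 0 1"
      by (intro image_subsetI M) simp
    ultimately have "g \<circ> Moebius_function 0 (- f a) holomorphic_on ball 0 1"
      using fg(2) by (metis holomorphic_on_compose_gen)
    then show ?thesis by (simp add: G_def[abs_def] o_def)
  qed
  have GU: "G w \<in> U" if "cmod w < 1" for w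
    unfolding G_def using fg(5) M[OF that] by blast
  have main: "cmod (u b - u a) \<le> cmod \<beta> * R"
    if u: "u holomorphic_on U" and R: "\<And>\<zeta>. \<zeta> \<in> U \<Longrightarrow> cmod (u \<zeta> - u a) \<le> R" for u R
  proof (rule field_le_epsilon)
    fix e :: real assume e: "e > 0"
    \<comment> \<open>The Schwarz lemma needs a strict bound, and \<open>R\<close> may be 0;
      \<open>e\<close> tends to 0 at the end.\<close>
    define c where "c = R + e"
    have c: "c > 0" "R < c" using R[OF a] e by (auto simp: c_def)
    define v where "v w = (u (G w) - u a) / complex_of_real c" for w
    have nv: "cmod (v w) = cmod (u (G w) - u a) / c" for w
      unfolding v_def norm_divide norm_of_real using c(1) by simp
    have "cmod (v \<beta>) \<le> cmod \<beta>"
    proof (rule Schwarz_Lemma(1))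
      have "G ` ball 0 1 \<subseteq> U" by (intro image_subsetI GU) simp
      then have "u \<circ> G holomorphic_on ball 0 1"
        using holomorphic_on_compose_gen[OF Ghol u] by blast
      then have "(\<lambda>w. u (G w)) holomorphic_on ball 0 1" unfolding o_def .
      then show "v holomorphic_on ball 0 1"
        unfolding v_def using c(1)
        by (intro holomorphic_on_divide holomorphic_on_diff holomorphic_on_const) auto
      show "cmod (v w) < 1" if "cmod w < 1" for w
        using R[OF GU[OF that]] c unfolding nv by simp
      show "v 0 = 0" unfolding v_def G0 by simp
      show "cmod \<beta> < 1" by (rule \<beta>)
    qed
    then have "cmod (u b - u a) \<le> cmod \<beta> * (R + e)"
      using c unfolding nv Gb by (simp add: c_def pos_divide_le_eq)
    also have "\<dots> \<le> cmod \<beta> * R + e"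
      using \<beta> e by (simp add: algebra_simps)
    finally show "cmod (u b - u a) \<le> cmod \<beta> * R + e" .
  qed
  show ?thesis
  proof (rule that[OF norm_ge_zero \<beta>])
    fix u R assume "u holomorphic_on U" "\<And>\<zeta>. \<zeta> \<in> U \<Longrightarrow> cmod (u \<zeta> - u a) \<le> R"
    then show "cmod (u b - u a) \<le> cmod \<beta> * R" by (rule main)
  qed
qed

lemma open_convex_ellipse:
  "open {\<zeta>::complex. cmod \<zeta> + cmod (1 - \<zeta>) < c}" "convex {\<zeta>::complex. cmod \<zeta> + cmod (1 - \<zeta>) < c}"
proof -
  have "continuous_on UNIV (\<lambda>\<zeta>. cmod \<zeta> + cmod (1 - \<zeta>))" by (intro continuous_intros)
  then show "open {\<zeta>::complex. cmod \<zeta> + cmod (1 - \<zeta>) < c}"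
    by (rule open_Collect_less[OF _ continuous_on_const])
  show "convex {\<zeta>::complex. cmod \<zeta> + cmod (1 - \<zeta>) < c}"
  proof (rule convexI)
    fix x y :: complex and s t :: real
    assume x: "x \<in> {\<zeta>. cmod \<zeta> + cmod (1 - \<zeta>) < c}" and y: "y \<in> {\<zeta>. cmod \<zeta> + cmod (1 - \<zeta>) < c}"
      and st: "0 \<le> s" "0 \<le> t" "s + t = 1"
    have 1: "cmod (s *\<^sub>R x + t *\<^sub>R y) \<le> s * cmod x + t * cmod y"
      using norm_triangle_ineq[of "s *\<^sub>R x" "t *\<^sub>R y"] st by simp
    have "of_real s + of_real t = (1::complex)" by (metis of_real_1 of_real_add st(3))
    then have "1 - (s *\<^sub>R x + t *\<^sub>R y) = s *\<^sub>R (1 - x) + t *\<^sub>R (1 - y)"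
      unfolding scaleR_conv_of_real by algebra
    then have 2: "cmod (1 - (s *\<^sub>R x + t *\<^sub>R y)) \<le> s * cmod (1 - x) + t * cmod (1 - y)"
      using norm_triangle_ineq[of "s *\<^sub>R (1 - x)" "t *\<^sub>R (1 - y)"] st by simp
    have "s * (cmod x + cmod (1 - x)) + t * (cmod y + cmod (1 - y)) < c"
      by (rule convex_bound_lt) (use x y st in auto)
    then show "s *\<^sub>R x + t *\<^sub>R y \<in> {\<zeta>. cmod \<zeta> + cmod (1 - \<zeta>) < c}"
      using 1 2 by (simp add: algebra_simps)
  qed
qed

text \<open>
  A strict self-map of the ball contracts the distance \<open>sup {\<bar>g x - g
  y\<bar>}\<close> over holomorphic \<open>g\<close> from the ball to the disc: \<open>F x +
  \<zeta> (F z - F x)\<close> stays in the ball for \<open>\<zeta>\<close> in an ellipse with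
  foci \<open>0\<close> and \<open>1\<close>, and the Schwarz lemma on that ellipse gains a
  factor below \<open>1\<close>.
\<close>

lemma ball_self_map_contraction:
  assumes r: "0 < \<eta>" "\<eta> < r"
  obtains k where "0 \<le> k" "k < 1"
    "\<And>(F::'a::complex_normed_vector \<Rightarrow> 'a) x y R (g::'a \<Rightarrow> complex).
      F \<in> Hol (ball 0 r) (cball 0 (r - \<eta>)) \<Longrightarrow> x \<in> ball 0 r \<Longrightarrow> y \<in> ball 0 r \<Longrightarrow>
      (\<And>g. g \<in> Hol (ball 0 r) (ball 0 1) \<Longrightarrow> cmod (g x - g y) \<le> R) \<Longrightarrow>
      g \<in> Hol (ball 0 r) (ball 0 1) \<Longrightarrow> cmod (g (F x) - g (F y)) \<le> k * R"
proof -
  \<comment> \<open>The choice gives \<open>(1 + e) * (r - \<eta>) = r - \<eta> * e < r\<close>: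
    combinations of two image points with coefficients of total modulus below \<open>1 + e\<close>
    stay in the ball.\<close>
  define e where "e = \<eta> / r"
  have e: "0 < e" "e < 1" using r by (auto simp: e_def)
  have "(1 + e) * (r - \<eta>) = r - \<eta> * e" using r by (simp add: e_def field_simps)
  then have e3: "(1 + e) * (r - \<eta>) < r" using r e by simp
  define U where "U = {\<zeta>. cmod \<zeta> + cmod (1 - \<zeta>) < 1 + e}"
  have "(2::complex) \<notin> U" using e by (simp add: U_def)
  then have "U \<noteq> UNIV" by blast
  moreover have "0 \<in> U" "1 \<in> U" using e by (auto simp: U_def)
  moreover have "open U" "convex U" unfolding U_def by (rule open_convex_ellipse)+
  ultimately have U: "open U" "convex U" "U \<noteq> UNIV" "0 \<in> U" "1 \<in> U" by blast+
  obtain k where k: "0 \<le> k" "k < 1"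
    "\<And>u R. u holomorphic_on U \<Longrightarrow> (\<And>\<zeta>. \<zeta> \<in> U \<Longrightarrow> cmod (u \<zeta> - u 0) \<le> R) \<Longrightarrow> cmod (u 1 - u 0) \<le> k * R"
    using convex_domain_contraction[OF U] by blast
  show ?thesis
  proof (rule that[OF k(1,2)])
    fix F :: "'a \<Rightarrow> 'a" and x y :: 'a and R and g :: "'a \<Rightarrow> complex"
    assume F: "F \<in> Hol (ball 0 r) (cball 0 (r - \<eta>))" and x: "x \<in> ball 0 r" and y: "y \<in> ball 0 r"
      and R: "\<And>g. g \<in> Hol (ball 0 r) (ball 0 1) \<Longrightarrow> cmod (g x - g y) \<le> R"
      and g: "g \<in> Hol (ball 0 r) (ball 0 1)"
    have mem: "F x + \<zeta> *\<^sub>C (F z - F x) \<in> ball 0 r" if z: "z \<in> ball 0 r" and \<zeta>: "\<zeta> \<in> U" for z \<zeta>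
    proof -
      have "F x + \<zeta> *\<^sub>C (F z - F x) = (1 - \<zeta>) *\<^sub>C F x + \<zeta> *\<^sub>C F z"
        using scaleC_add_left[of "1 - \<zeta>" \<zeta> "F x"] by (simp add: scaleC_diff_right algebra_simps)
      also have "norm \<dots> \<le> cmod (1 - \<zeta>) * norm (F x) + cmod \<zeta> * norm (F z)"
        using norm_triangle_ineq by (metis norm_scaleC)
      also have "\<dots> \<le> cmod (1 - \<zeta>) * (r - \<eta>) + cmod \<zeta> * (r - \<eta>)"
        using Hol_mem[OF F x] Hol_mem[OF F z] by (intro add_mono mult_left_mono) auto
      also have "\<dots> = (cmod \<zeta> + cmod (1 - \<zeta>)) * (r - \<eta>)" by (simp add: algebra_simps)
      also have "\<dots> \<le> (1 + e) * (r - \<eta>)"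
        using \<zeta> r by (intro mult_right_mono) (auto simp: U_def)
      finally show ?thesis using e3 by simp
    qed
    define u where "u \<zeta> = g (F x + \<zeta> *\<^sub>C (F y - F x))" for \<zeta>
    have "u \<in> Hol U (ball 0 1)"
      unfolding u_def by (rule Hol_compose[OF Hol_mono[OF Hol_line] g]) (use mem[OF y] in auto)
    then have "u holomorphic_on U" by (rule Hol_imp_holomorphic)
    \<comment> \<open>The map sending \<open>z\<close> to
      \<open>g (F x + \<zeta> *\<^sub>C (F z - F x))\<close> is itself a competitor in the distance
      of \<open>x\<close> and \<open>y\<close>; its values there are \<open>u 0\<close> and
      \<open>u \<zeta>\<close>.\<close>
    moreover have "cmod (u \<zeta> - u 0) \<le> R" if \<zeta>: "\<zeta> \<in> U" for \<zeta>
    proof -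
      have "(\<lambda>z. F x + \<zeta> *\<^sub>C (F z - F x)) \<in> Hol (ball 0 r) UNIV"
        by (rule Hol_add[OF Hol_const[OF UNIV_I] Hol_cmult[OF Hol_diff[OF F Hol_const[OF UNIV_I]]]])
      then have "(\<lambda>z. F x + \<zeta> *\<^sub>C (F z - F x)) \<in> Hol (ball 0 r) (ball 0 r)"
        by (rule Hol_mono) (use mem \<zeta> in auto)
      then have "(\<lambda>z. g (F x + \<zeta> *\<^sub>C (F z - F x))) \<in> Hol (ball 0 r) (ball 0 1)"
        by (rule Hol_compose[OF _ g])
      from R[OF this] show ?thesis by (simp add: u_def norm_minus_commute)
    qed
    ultimately have "cmod (u 1 - u 0) \<le> k * R" by (rule k(3))
    then show "cmod (g (F x) - g (F y)) \<le> k * R" by (simp add: u_def norm_minus_commute)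
  qed
qed

text \<open>A norming functional for \<open>x - y\<close>, divided by \<open>r\<close>, is one of
  the test functions \<open>g\<close>.\<close>

lemma norm_diff_le_of_Hol_disc:
  fixes x y :: "'a::complex_normed_vector"
  assumes r: "r > 0" and R: "\<And>g. g \<in> Hol (ball 0 r) (ball 0 1) \<Longrightarrow> cmod (g x - g y) \<le> R"
  shows "norm (x - y) \<le> r * R"
proof -
  obtain l where l: "l \<in> cdual" "\<And>z. cmod (l z) \<le> norm z" "l (x - y) = complex_of_real (norm (x - y))"
    using complex_norming_functional by blast
  define g where "g z = (1 / r) *\<^sub>R l z" for z
  have "g \<in> Hol (ball 0 r) UNIV"
    unfolding g_def using l(1) Hol_scaleR[OF Hol_bounded_clinear] by (simp add: cdual_def)
  then have "g \<in> Hol (ball 0 r) (ball 0 1)"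
  proof (rule Hol_mono[OF _ order_refl])
    fix z :: 'a assume "z \<in> ball 0 r"
    then have "cmod (l z) < r" using l(2)[of z] by simp
    then show "g z \<in> ball 0 1" using r by (simp add: g_def field_simps)
  qed
  then have "cmod (g x - g y) \<le> R" by (rule R)
  moreover have "g x - g y = (1 / r) *\<^sub>R complex_of_real (norm (x - y))"
    unfolding g_def l(3)[symmetric] by (simp add: cdualD(4)[OF l(1)] scaleR_diff_right)
  ultimately show ?thesis using r by (simp add: field_simps)
qed

text \<open>The contraction factor does not depend on the map, so the iterates started at 0 converge
  uniformly in the parameter and their limit is holomorphic. The hypothesis \<open>par\<close>
  replaces joint holomorphy: it is just what keeps the iterates holomorphic in
  \<open>p\<close>.\<close>

theorem Earle_Hamilton_ball:
  fixes F :: "'e::complex_normed_vector \<Rightarrow> 'a::complex_banach \<Rightarrow> 'a"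
  assumes r: "0 < \<eta>" "\<eta> < r" and L: "open L"
    and F: "\<And>p. p \<in> L \<Longrightarrow> F p \<in> Hol (ball 0 r) (cball 0 (r - \<eta>))"
    and par: "\<And>y. y \<in> Hol L (ball 0 r) \<Longrightarrow> (\<lambda>p. F p (y p)) \<in> Hol L UNIV"
  obtains y where "y \<in> Hol L (ball 0 r)"
    "\<And>p z. p \<in> L \<Longrightarrow> z \<in> ball 0 r \<Longrightarrow> F p z = z \<longleftrightarrow> z = y p"
proof -
  obtain k where k: "0 \<le> k" "k < 1"
    "\<And>(F::'a \<Rightarrow> 'a) x y R (g::'a \<Rightarrow> complex).
      F \<in> Hol (ball 0 r) (cball 0 (r - \<eta>)) \<Longrightarrow> x \<in> ball 0 r \<Longrightarrow> y \<in> ball 0 r \<Longrightarrow>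
      (\<And>g. g \<in> Hol (ball 0 r) (ball 0 1) \<Longrightarrow> cmod (g x - g y) \<le> R) \<Longrightarrow>
      g \<in> Hol (ball 0 r) (ball 0 1) \<Longrightarrow> cmod (g (F x) - g (F y)) \<le> k * R"
    using ball_self_map_contraction[OF r] by blast
  have FB: "F p z \<in> ball 0 r" if "p \<in> L" "z \<in> ball 0 r" for p z
    using Hol_mem[OF F[OF that(1)] that(2)] r by auto
  have itB: "(F p ^^ n) z \<in> ball 0 r" if "p \<in> L" "z \<in> ball 0 r" for p n z
    using that FB by (induction n) auto
  have gbound: "cmod (g ((F p ^^ n) x) - g ((F p ^^ n) y)) \<le> k ^ n * 2"
    if p: "p \<in> L" and x: "x \<in> ball 0 r" and y: "y \<in> ball 0 r" and g: "g \<in> Hol (ball 0 r) (ball 0 1)"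
    for p n x y g
    using g
  proof (induction n arbitrary: g)
    \<comment> \<open>Two points of the unit disc differ by at most 2, the origin of that factor.
      The induction keeps \<open>g\<close> arbitrary because the contraction lemma asks for the
      bound for all test functions.\<close>
    case 0
    then show ?case
      using Hol_mem[OF 0 x] Hol_mem[OF 0 y] norm_triangle_ineq4[of "g x" "g y"] by simp
  next
    case (Suc n)
    show ?case
      using k(3)[OF F[OF p] itB[OF p x, of n] itB[OF p y, of n] Suc.IH Suc.prems]
      by (simp add: mult.assoc)
  qed
  have bound: "norm ((F p ^^ n) x - (F p ^^ n) y) \<le> r * (k ^ n * 2)"
    if "p \<in> L" "x \<in> ball 0 r" "y \<in> ball 0 r" for p n x y
  proof (rule norm_diff_le_of_Hol_disc)
    show "r > 0" using r by simp
  qed (rule gbound[OF that])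
  have lim0: "(\<lambda>n. r * (k ^ n * 2)) \<longlonglongrightarrow> 0"
    using tendsto_mult[OF tendsto_const tendsto_mult[OF LIMSEQ_power_zero tendsto_const], of k r 2] k by simp
  define s where "s n p = (F p ^^ n) 0" for n p
  have zero: "(0::'a) \<in> ball 0 r" using r by simp
  have sB: "s n p \<in> ball 0 r" if "p \<in> L" for n p
    unfolding s_def using itB[OF that zero] .
  have sHol: "s n \<in> Hol L (ball 0 r)" for n
  proof (induction n)
    case 0
    then show ?case using Hol_const[OF zero] by (simp add: s_def[abs_def])
  next
    case (Suc n)
    show ?case
      using Hol_mono[OF par[OF Suc.IH] order_refl, of "ball 0 r"] FB sB by (simp add: s_def[abs_def])
  qed
  have sbound: "norm (s (n + m) p - s n p) \<le> r * (k ^ n * 2)" if "p \<in> L" for n m p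
    unfolding s_def funpow_add o_apply by (rule bound[OF that itB[OF that zero] zero])
  have "uniformly_Cauchy_on L s"
    unfolding uniformly_Cauchy_on_def
  proof (intro allI impI)
    fix e :: real assume "e > 0"
    then obtain N where N: "r * (k ^ N * 2) < e / 2"
      using order_tendstoD(2)[OF lim0, of "e / 2"] eventually_sequentially by auto
    have "dist (s m p) (s n p) < e" if "p \<in> L" "m \<ge> N" "n \<ge> N" for p m n
      using sbound[OF that(1), of N "m - N"] sbound[OF that(1), of N "n - N"] that N
        dist_triangle2[of "s m p" "s n p" "s N p"] by (simp add: dist_norm)
    then show "\<exists>M. \<forall>x\<in>L. \<forall>m\<ge>M. \<forall>n\<ge>M. dist (s m x) (s n x) < e" by blast
  qed
  then obtain y where y: "uniform_limit L s y sequentially"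
    using Cauchy_uniformly_convergent uniformly_convergent_on_def by blast
  have lim: "(\<lambda>n. s n p) \<longlonglongrightarrow> y p" if "p \<in> L" for p
    using tendsto_uniform_limitI[OF y that] .
  have yB: "y p \<in> ball 0 r" if "p \<in> L" for p
  proof -
    \<comment> \<open>All iterates but the first lie in a fixed smaller closed ball, so the limit
      cannot reach the sphere.\<close>
    have "s (Suc n) p \<in> cball 0 (r - \<eta>)" for n
      using Hol_mem[OF F[OF that] sB[OF that, of n]] by (simp add: s_def)
    then have "y p \<in> cball 0 (r - \<eta>)"
      by (rule closed_sequentially[OF closed_cball _ LIMSEQ_Suc[OF lim[OF that]]])
    then show ?thesis using r by auto
  qed
  have "y \<in> Hol L UNIV" using Hol_uniform_limit[OF L Hol_UNIV[OF sHol] y] .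
  then have "y \<in> Hol L (ball 0 r)" by (rule Hol_mono) (use yB in auto)
  moreover have "F p z = z \<longleftrightarrow> z = y p" if p: "p \<in> L" and z: "z \<in> ball 0 r" for p z
  proof -
    have "(\<lambda>n. F p (s n p)) \<longlonglongrightarrow> F p (y p)"
      using isCont_tendsto_compose[OF Hol_continuous[OF F[OF p] yB[OF p]] lim[OF p]] .
    moreover have "(\<lambda>n. F p (s n p)) \<longlonglongrightarrow> y p"
      using LIMSEQ_Suc[OF lim[OF p]] by (simp add: s_def)
    ultimately have fp: "F p (y p) = y p" using LIMSEQ_unique by blast
    have "z = y p" if "F p z = z"
    proof -
      have "(F p ^^ n) w = w" if "F p w = w" for n w using that by (induction n) auto
      then have "norm (z - y p) \<le> r * (k ^ n * 2)" for n
        using bound[OF p z yB[OF p], of n] that fp by simp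
      then have "norm (z - y p) \<le> 0"
        using LIMSEQ_le_const[OF lim0] by blast
      then show ?thesis by simp
    qed
    with fp show ?thesis by blast
  qed
  ultimately show ?thesis using that by blast
qed

section \<open>Null points and numerical ranges\<close>

text \<open>Zeros of \<open>f p\<close> are fixed points of
  \<open>z - \<tau> *\<^sub>R f p z\<close>. Suppose the image \<open>z\<close> of \<open>y\<close>
  lay outside the ball of radius \<open>r - \<eta>\<close>. Coercivity at \<open>z\<close>, not at
  \<open>y\<close>, shows that \<open>z + \<tau> *\<^sub>R f p z\<close> has norm at least
  \<open>norm z + \<tau> * c\<close>. But it equals
  \<open>y + \<tau> *\<^sub>R (f p z - f p y)\<close>, whose norm is at most \<open>r\<close> plus
  an error of order \<tau>^2.\<close>

theorem null_point_ball:
  fixes f :: "'e::complex_normed_vector \<Rightarrow> 'a::complex_banach \<Rightarrow> 'a"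
  assumes r: "0 < r0" "r0 < r" "r < r'" "r' \<le> 1" and L: "open L"
    and hol: "\<And>p. p \<in> L \<Longrightarrow> f p \<in> Hol (ball 0 r') UNIV"
    and bounded: "\<And>p z. p \<in> L \<Longrightarrow> z \<in> ball 0 r' \<Longrightarrow> norm (f p z) \<le> M"
    and c: "0 < c"
    and coercive: "\<And>p z l. p \<in> L \<Longrightarrow> r0 \<le> norm z \<Longrightarrow> norm z < r' \<Longrightarrow> l \<in> duality_map z \<Longrightarrow> c \<le> Re (l (f p z))"
    and par: "\<And>y. y \<in> Hol L (ball 0 r) \<Longrightarrow> (\<lambda>p. f p (y p)) \<in> Hol L UNIV"
  obtains y where "y \<in> Hol L (ball 0 r)"
    "\<And>p z. p \<in> L \<Longrightarrow> z \<in> ball 0 r \<Longrightarrow> f p z = 0 \<longleftrightarrow> z = y p"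
proof -
  define N where "N = max M 1"
  have N: "N > 0" "\<And>p z. p \<in> L \<Longrightarrow> z \<in> ball 0 r' \<Longrightarrow> norm (f p z) \<le> N"
    using bounded by (auto simp: N_def le_max_iff_disj)
  define \<rho> where "\<rho> = (r + r') / 2"
  have \<rho>: "r < \<rho>" "\<rho> < r'" using r by (auto simp: \<rho>_def)
  define K where "K = N / (r' - \<rho>)"
  have K: "K > 0" using N \<rho> by (simp add: K_def)
  have lip: "norm (f p x - f p y) \<le> K * norm (x - y)"
    if "p \<in> L" "x \<in> cball 0 \<rho>" "y \<in> cball 0 \<rho>" for p x y
    unfolding K_def by (rule Hol_Lipschitz[OF hol[OF that(1)] \<rho>(2) N(2)[OF that(1)] that(2,3)])
  \<comment> \<open>The first bound keeps images inside \<open>cball 0 \<rho>\<close>, where the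
    Lipschitz estimate holds; the second makes the Lipschitz error at most half of the gain
    \<open>\<tau> * c\<close>.\<close>
  define \<tau> where "\<tau> = min ((\<rho> - r) / N) (c / (2 * K * N))"
  have \<tau>: "\<tau> > 0" using \<rho> N K c by (simp add: \<tau>_def)
  have "\<tau> \<le> (\<rho> - r) / N" "\<tau> \<le> c / (2 * K * N)" by (auto simp: \<tau>_def)
  then have \<tau>1: "\<tau> * N \<le> \<rho> - r" and \<tau>2: "\<tau> * (K * N) \<le> c / 2"
    using N K by (simp_all add: field_simps)
  \<comment> \<open>The first bound is the half of the gain that survives; the second puts any
    violating image into the shell where coercivity is assumed.\<close>
  define \<eta> where "\<eta> = min (\<tau> * c / 2) (r - r0)"
  have \<eta>: "0 < \<eta>" "\<eta> < r" "r0 \<le> r - \<eta>" "\<eta> \<le> \<tau> * c / 2"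
    using \<tau> c r by (auto simp: \<eta>_def min_def)
  define F where "F p z = z - \<tau> *\<^sub>R f p z" for p z
  have into: "F p y \<in> cball 0 (r - \<eta>)" if p: "p \<in> L" and y: "y \<in> ball 0 r" for p y
  proof (rule ccontr)
    define z where "z = F p y"
    assume "F p y \<notin> cball 0 (r - \<eta>)"
    then have zr: "r - \<eta> < norm z" by (simp add: z_def)
    have yr: "norm y \<le> r" using y by simp
    have fy: "norm (f p y) \<le> N" using N(2)[OF p] y r by auto
    have zy: "norm (z - y) \<le> \<tau> * N"
      using fy \<tau> by (simp add: z_def F_def)
    then have z\<rho>: "norm z \<le> \<rho>"
      using norm_triangle_ineq[of y "z - y"] yr \<tau>1 by simp
    have z0: "0 < norm z" "norm z \<le> 1" using zr \<eta> r z\<rho> \<rho> by auto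
    obtain l where l: "l \<in> duality_map z" using duality_map_nonempty by blast
    then have l': "l \<in> cdual" "\<And>w. cmod (l w) \<le> norm z * norm w" "l z = complex_of_real ((norm z)\<^sup>2)"
      by (simp_all add: duality_map_iff)
    have "c \<le> Re (l (f p z))"
      by (rule coercive[OF p _ _ l]) (use zr \<eta> z\<rho> \<rho> in auto)
    then have "\<tau> * c \<le> \<tau> * Re (l (f p z))" using \<tau> by simp
    \<comment> \<open>Functionals in the duality map of \<open>z\<close> have norm
      \<open>norm z\<close>; since \<open>norm z\<close> is at most 1, dividing by it does not spoil
      the constant \<open>c\<close>.\<close>
    moreover have "norm z * (\<tau> * c) \<le> \<tau> * c"
      using z0 \<tau> c by (intro mult_left_le_one_le) auto
    ultimately have "norm z * (norm z + \<tau> * c) \<le> Re (l (z + \<tau> *\<^sub>R f p z))"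
      by (simp add: cdualD[OF l'(1)] l'(3) power2_eq_square algebra_simps)
    also have "\<dots> \<le> norm z * norm (z + \<tau> *\<^sub>R f p z)"
      using l'(2) complex_Re_le_cmod order_trans by blast
    also have "z + \<tau> *\<^sub>R f p z = y + \<tau> *\<^sub>R (f p z - f p y)"
      by (simp add: z_def F_def algebra_simps)
    finally have "norm z + \<tau> * c \<le> norm (y + \<tau> *\<^sub>R (f p z - f p y))"
      using z0 by simp
    also have "\<dots> \<le> r + \<tau> * norm (f p z - f p y)"
      using norm_triangle_ineq[of y "\<tau> *\<^sub>R (f p z - f p y)"] yr \<tau> by simp
    also have "norm (f p z - f p y) \<le> K * norm (z - y)"
      by (rule lip[OF p]) (use z\<rho> yr \<rho> in auto)
    also have "K * norm (z - y) \<le> K * (\<tau> * N)" using zy K by simp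
    also have "K * (\<tau> * N) \<le> c / 2" using \<tau>2 by (simp add: mult_ac)
    finally have "norm z + \<tau> * c \<le> r + \<tau> * (c / 2)" using \<tau> by simp
    then show False using zr \<eta>(4) by simp
  qed
  have Fhol: "F p \<in> Hol (ball 0 r) (cball 0 (r - \<eta>))" if p: "p \<in> L" for p
  proof (rule Hol_mono)
    show "F p \<in> Hol (ball 0 r') UNIV"
      unfolding F_def by (rule Hol_diff[OF Hol_ident Hol_scaleR[OF hol[OF p]]])
  qed (use r into[OF p] in auto)
  obtain y where y: "y \<in> Hol L (ball 0 r)"
    "\<And>p z. p \<in> L \<Longrightarrow> z \<in> ball 0 r \<Longrightarrow> F p z = z \<longleftrightarrow> z = y p"
  proof (rule Earle_Hamilton_ball[OF \<eta>(1,2) L Fhol])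
    fix y :: "'e \<Rightarrow> 'a" assume y: "y \<in> Hol L (ball 0 r)"
    show "(\<lambda>p. F p (y p)) \<in> Hol L UNIV"
      unfolding F_def by (rule Hol_diff[OF y Hol_scaleR[OF par[OF y]]])
  qed blast+
  have "F p z = z \<longleftrightarrow> f p z = 0" for p z using \<tau> by (simp add: F_def)
  with y show ?thesis using that by blast
qed

text \<open>
  The solution \<open>y(t)\<close> of \<open>y - t Q(y) = w\<close> exists for
  \<open>\<bar>t\<bar> < T\<close> and has \<open>Q w\<close> as its derivative at
  \<open>0\<close>, which the Cauchy estimate bounds.
\<close>

lemma norm_le_of_numerical_bound:
  fixes Q :: "'a::complex_banach \<Rightarrow> 'a"
  assumes Q: "Q \<in> Hol (ball 0 s) UNIV" and s: "s \<le> 1"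
    and M: "\<And>z. z \<in> ball 0 s \<Longrightarrow> norm (Q z) \<le> M"
    and W: "\<And>z l. z \<in> ball 0 s \<Longrightarrow> l \<in> duality_map z \<Longrightarrow> cmod (l (Q z)) \<le> W * norm z"
    and T: "T > 0" "W \<ge> 0" "T * W + norm w < s"
  shows "norm (Q w) \<le> s / T"
proof -
  \<comment> \<open>For \<open>cmod t < T\<close> the numerical bound gives
    \<open>norm z * (norm z - r0)\<close> as lower bound for \<open>Re (l (f t z))\<close>, so
    coercivity starts beyond \<open>r0\<close>. The radii \<open>r1\<close> and \<open>r\<close> cut
    the remaining gap up to \<open>s\<close> into thirds.\<close>
  define r0 where "r0 = T * W + norm w"
  define r1 where "r1 = r0 + (s - r0) / 3"
  define r where "r = r0 + 2 * (s - r0) / 3"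
  have r0: "0 \<le> r0" "r0 < s" using T by (auto simp: r0_def)
  have r: "0 < r1" "r1 < r" "r < s" "r0 < r1" using r0 by (auto simp: r1_def r_def field_simps)
  define f where "f t z = z - t *\<^sub>C Q z - w" for t z
  have wr: "norm w \<le> r0" using T by (simp add: r0_def)
  have par: "(\<lambda>t. f t (y t)) \<in> Hol (ball 0 T) UNIV" if y: "y \<in> Hol (ball 0 T) (ball 0 r)" for y
  proof -
    have "y \<in> Hol (ball 0 T) (ball 0 s)" by (rule Hol_mono[OF y order_refl]) (use Hol_mem[OF y] r in fastforce)
    then show ?thesis
      unfolding f_def
      by (intro Hol_diff[OF Hol_diff[OF y Hol_scaleC[OF Hol_ident Hol_compose[OF _ Q]]] Hol_const]) auto
  qed
  \<comment> \<open>The a priori bound \<open>M\<close> serves the existence of \<open>y\<close> and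
    leaves no trace in the final estimate.\<close>
  obtain y where y: "y \<in> Hol (ball 0 T) (ball 0 r)"
    "\<And>t z. t \<in> ball 0 T \<Longrightarrow> z \<in> ball 0 r \<Longrightarrow> f t z = 0 \<longleftrightarrow> z = y t"
  proof (rule null_point_ball[OF r(1-3) s open_ball _ _ _ _ par])
    fix t :: complex assume "t \<in> ball 0 T"
    show "f t \<in> Hol (ball 0 s) UNIV"
      unfolding f_def by (rule Hol_diff[OF Hol_diff[OF Hol_ident Hol_cmult[OF Q]] Hol_const[OF UNIV_I]])
  next
    fix t :: complex and z :: 'a assume t: "t \<in> ball 0 T" and z: "z \<in> ball 0 s"
    have "norm (f t z) \<le> norm z + cmod t * norm (Q z) + norm w"
      unfolding f_def
      using norm_triangle_ineq4[of "z - t *\<^sub>C Q z" w] norm_triangle_ineq4[of z "t *\<^sub>C Q z"]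
      by (simp add: norm_scaleC)
    also have "\<dots> \<le> s + T * M + s"
      using t z M[OF z] wr r0 T by (intro add_mono mult_mono) auto
    finally show "norm (f t z) \<le> s + T * M + s" .
  next
    show "0 < r1 * (r1 - r0)" using r by simp
    fix t :: complex and z :: 'a and l
    assume t: "t \<in> ball 0 T" and z: "r1 \<le> norm z" "norm z < s" and l: "l \<in> duality_map z"
    then have l': "l \<in> cdual" "\<And>w. cmod (l w) \<le> norm z * norm w" "l z = complex_of_real ((norm z)\<^sup>2)"
      by (simp_all add: duality_map_iff)
    have "Re (t * l (Q z)) \<le> cmod t * cmod (l (Q z))"
      using complex_Re_le_cmod norm_mult by metis
    also have "\<dots> \<le> T * (W * norm z)"
      using t W[of z l] z l T by (intro mult_mono) auto
    finally have 1: "Re (t * l (Q z)) \<le> T * W * norm z" by simp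
    have 2: "Re (l w) \<le> norm z * norm w"
      using l'(2)[of w] complex_Re_le_cmod order_trans by blast
    have "Re (l (f t z)) = (norm z)\<^sup>2 - Re (t * l (Q z)) - Re (l w)"
      unfolding f_def by (simp add: cdualD[OF l'(1)] l'(3))
    then have "norm z * (norm z - r0) \<le> Re (l (f t z))"
      using 1 2 by (simp add: r0_def power2_eq_square algebra_simps)
    moreover have "r1 * (r1 - r0) \<le> norm z * (norm z - r0)"
      using z r by (intro mult_mono) auto
    ultimately show "r1 * (r1 - r0) \<le> Re (l (f t z))" by simp
  qed blast+
  have yB: "y t \<in> ball 0 r" if "t \<in> ball 0 T" for t using Hol_mem[OF y(1) that] .
  have eq: "y t = t *\<^sub>C Q (y t) + w" if "t \<in> ball 0 T" for t
    using y(2)[OF that yB[OF that]] by (simp add: f_def algebra_simps)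
  have T0: "(0::complex) \<in> ball 0 T" using T by simp
  have y0: "y 0 = w" using eq[OF T0] by simp
  obtain y' where y': "bounded_clinear y'" "(y has_derivative y') (at 0)"
    using HolE[OF y(1) T0] .
  have "(\<lambda>t. Q (y t)) \<in> Hol (ball 0 T) UNIV"
    by (rule Hol_compose[OF Hol_mono[OF y(1) order_refl] Q]) (use yB r in force)
  then obtain q' where q': "bounded_clinear q'" "((\<lambda>t. Q (y t)) has_derivative q') (at 0)"
    using HolE T0 by blast
  have "((\<lambda>t. t *\<^sub>C Q (y t) + w) has_derivative (\<lambda>h. 0 *\<^sub>C q' h + h *\<^sub>C Q (y 0) + 0)) (at 0)"
    by (intro has_derivative_add has_derivative_const bounded_bilinear.FDERIV[OF bounded_bilinear_scaleC]
        has_derivative_ident q'(2))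
  then have "(y has_derivative (\<lambda>h. 0 *\<^sub>C q' h + h *\<^sub>C Q (y 0) + 0)) (at 0)"
    by (rule has_derivative_transform_within_open[OF _ open_ball T0]) (use eq in auto)
  then have "y' 1 = Q w"
    using has_derivative_unique[OF y'(2)] y0 by simp
  moreover have "norm (y' 1) \<le> r / T * norm (1::complex)"
  proof (rule Hol_derivative_bound[OF Hol_UNIV[OF y(1)] T(1) _ y'(2)])
    fix t assume "t \<in> ball (0::complex) T"
    then show "norm (y t) \<le> r" using yB by force
  qed
  moreover have "r / T \<le> s / T" using r T by (intro divide_right_mono) auto
  ultimately show ?thesis by simp
qed

section \<open>One-variable estimates: real parts and averages over roots of unity\<close>

lemma Caratheodory_bound:
  assumes u: "u holomorphic_on ball 0 R" and R: "0 < R" and u0: "u 0 = 0"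
    and A: "\<And>\<zeta>. \<zeta> \<in> ball 0 R \<Longrightarrow> Re (u \<zeta>) < A" and \<zeta>: "cmod \<zeta> < R"
  shows "cmod (u \<zeta>) * (R - cmod \<zeta>) \<le> 2 * A * cmod \<zeta>"
proof -
  have A0: "A > 0" using A[of 0] R u0 by simp
  \<comment> \<open>The Moebius map of the half-plane \<open>Re < A\<close> onto the unit disc that
    fixes 0, so the Schwarz lemma applies to \<open>v\<close>.\<close>
  define v where "v w = u (R *\<^sub>R w) / (2 * A - u (R *\<^sub>R w))" for w
  have mem: "R *\<^sub>R w \<in> ball 0 R" if "cmod w < 1" for w using that R by simp
  have nz: "2 * A - u (R *\<^sub>R w) \<noteq> 0" if "cmod w < 1" for w
  proof
    assume "2 * A - u (R *\<^sub>R w) = 0"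
    then have "Re (2 * A - u (R *\<^sub>R w)) = 0" by simp
    then show False using A[OF mem[OF that]] A0 by simp
  qed
  have lt: "cmod (u (R *\<^sub>R w)) < cmod (2 * A - u (R *\<^sub>R w))" if "cmod w < 1" for w
  proof -
    define a b where "a = Re (u (R *\<^sub>R w))" and "b = Im (u (R *\<^sub>R w))"
    have "a < A" using A[OF mem[OF that]] by (simp add: a_def)
    then have "0 < 4 * A * (A - a)" using A0 by simp
    then have "a\<^sup>2 + b\<^sup>2 < (2 * A - a)\<^sup>2 + b\<^sup>2" by (simp add: power2_eq_square algebra_simps)
    then show ?thesis by (simp add: cmod_def a_def b_def)
  qed
  define w where "w = \<zeta> / of_real R"
  have w: "cmod w < 1" "R *\<^sub>R w = \<zeta>" "cmod w = cmod \<zeta> / R"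
    using \<zeta> R by (auto simp: w_def norm_divide scaleR_conv_of_real)
  have "cmod (v w) \<le> cmod w"
  proof (rule Schwarz_Lemma(1))
    have "(*\<^sub>R) R ` ball (0::complex) 1 \<subseteq> ball 0 R" using mem by auto
    moreover have "(*\<^sub>R) R holomorphic_on ball (0::complex) 1"
      unfolding scaleR_conv_of_real by (intro holomorphic_intros)
    ultimately have "(\<lambda>w. u (R *\<^sub>R w)) holomorphic_on ball 0 1"
      using holomorphic_on_compose_gen[OF _ u, of "(*\<^sub>R) R" "ball 0 1"] by (simp add: o_def)
    then show "v holomorphic_on ball 0 1"
      unfolding v_def using nz
      by (intro holomorphic_on_divide holomorphic_on_diff holomorphic_on_const) auto
    show "v 0 = 0" by (simp add: v_def u0)
    show "cmod (v z) < 1" if "cmod z < 1" for z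
      using lt[OF that] nz[OF that] by (simp add: v_def norm_divide)
  qed (rule w(1))
  then have "cmod (u \<zeta>) \<le> cmod \<zeta> / R * cmod (2 * A - u \<zeta>)"
    using nz[OF w(1)] w by (simp add: v_def norm_divide divide_le_eq)
  also have "\<dots> \<le> cmod \<zeta> / R * (2 * A + cmod (u \<zeta>))"
    using norm_triangle_ineq4[of "complex_of_real (2 * A)" "u \<zeta>"] A0 R by (intro mult_left_mono) auto
  finally have "cmod (u \<zeta>) * R \<le> cmod \<zeta> * (2 * A + cmod (u \<zeta>))"
    using R by (simp add: field_simps)
  then show ?thesis by (simp add: algebra_simps)
qed

text \<open>\<open>C\<close> is obtained before \<open>\<phi>\<close>, so one constant serves all
  directions and functionals at once. The one-sided bound comes from the maximum principle, and the
  Caratheodory inequality turns it into a bound for the modulus.\<close>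

lemma bounded_of_boundary_real_part:
  assumes R: "0 < R" "R < 1" "0 \<le> R1" "R1 < R"
  obtains C where "\<And>\<phi> \<zeta>. \<lbrakk>\<phi> holomorphic_on ball 0 1; \<And>\<zeta>. cmod \<zeta> = R \<Longrightarrow> Re (cnj \<zeta> * \<phi> \<zeta>) \<le> K;
    cmod (\<phi> 0) \<le> A0; cmod (deriv \<phi> 0) \<le> A1; cmod \<zeta> \<le> R1\<rbrakk> \<Longrightarrow> cmod (\<phi> \<zeta>) \<le> C"
proof -
  \<comment> \<open>A strict upper bound for \<open>Re (H z - H 0)\<close> with \<open>H\<close> as
    below: \<open>H 0\<close> is the derivative of \<open>\<phi>\<close> at 0, and the summand 1
    supplies strictness.\<close>
  define A where "A = \<bar>K\<bar> / R\<^sup>2 + \<bar>A1\<bar> + 1"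
  define G where "G = 2 * A * R1 / (R - R1)"
  define C where "C = A0 + R1 * (G + A1 + A0 * R1 / R\<^sup>2)"
  have "cmod (\<phi> \<zeta>) \<le> C"
    if \<phi>: "\<phi> holomorphic_on ball 0 1" and bd: "\<And>\<zeta>. cmod \<zeta> = R \<Longrightarrow> Re (cnj \<zeta> * \<phi> \<zeta>) \<le> K"
      and a: "cmod (\<phi> 0) \<le> A0" "cmod (deriv \<phi> 0) \<le> A1" and \<zeta>: "cmod \<zeta> \<le> R1" for \<phi> \<zeta>
  proof -
    obtain \<psi> where \<psi>: "\<psi> holomorphic_on ball 0 1" "\<And>z. cmod z < 1 \<Longrightarrow> \<phi> z - \<phi> 0 = z * \<psi> z"
      "deriv (\<lambda>z. \<phi> z - \<phi> 0) 0 = \<psi> 0"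
    proof (rule Schwarz3[of "\<lambda>z. \<phi> z - \<phi> 0" 1])
      show "(\<lambda>z. \<phi> z - \<phi> 0) holomorphic_on ball 0 1" by (intro holomorphic_intros \<phi>)
    qed auto
    have d0: "\<psi> 0 = deriv \<phi> 0"
      using \<psi>(3) holomorphic_on_imp_differentiable_at[OF \<phi>, of 0] by simp
    \<comment> \<open>On the circle of radius \<open>R\<close> the added term is the conjugate of
      \<open>\<phi> 0 / z\<close>, so \<open>H z\<close> has the same real part there as
      \<open>\<phi> z / z\<close>.\<close>
    define H where "H z = \<psi> z + z * (cnj (\<phi> 0) / of_real (R\<^sup>2))" for z
    have H: "H holomorphic_on ball 0 1" unfolding H_def by (intro holomorphic_intros \<psi>)
    have ReH: "Re (H z) \<le> K / R\<^sup>2" if "z \<in> cball 0 R" for z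
    proof (rule maximum_real_frontier[of H "cball 0 R"])
      show "H holomorphic_on interior (cball 0 R)"
        by (rule holomorphic_on_subset[OF H]) (use R in auto)
      show "continuous_on (closure (cball 0 R)) H"
        by (rule continuous_on_subset[OF holomorphic_on_imp_continuous_on[OF H]]) (use R in auto)
      fix w assume "w \<in> frontier (cball (0::complex) R)"
      then have w: "cmod w = R" using R by simp
      then have w0: "w \<noteq> 0" using R by auto
      have ww: "cnj w * w = of_real (R\<^sup>2)"
        using complex_norm_square[of w] w by (simp add: mult.commute)
      have "of_real (R\<^sup>2) * H w = cnj w * (w * \<psi> w) + w * cnj (\<phi> 0)"
        using R ww[symmetric] w0 by (simp add: H_def field_simps del: of_real_power)
      also have "w * \<psi> w = \<phi> w - \<phi> 0" using \<psi>(2) w R by simp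
      finally have E: "of_real (R\<^sup>2) * H w = cnj w * (\<phi> w - \<phi> 0) + w * cnj (\<phi> 0)" .
      have "R\<^sup>2 * Re (H w) = Re (of_real (R\<^sup>2) * H w)" by (simp del: of_real_power)
      also have "\<dots> = Re (cnj w * \<phi> w) - Re (cnj w * \<phi> 0) + Re (w * cnj (\<phi> 0))"
        unfolding E by (simp add: right_diff_distrib)
      also have "Re (cnj w * \<phi> 0) = Re (w * cnj (\<phi> 0))" by simp
      finally have "R\<^sup>2 * Re (H w) \<le> K" using bd[OF w] by simp
      then show "Re (H w) \<le> K / R\<^sup>2" using R by (simp add: field_simps)
    qed (use that in auto)
    have "cmod (H \<zeta> - H 0) * (R - cmod \<zeta>) \<le> 2 * A * cmod \<zeta>"
    proof (rule Caratheodory_bound)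
      show "(\<lambda>z. H z - H 0) holomorphic_on ball 0 R"
        by (intro holomorphic_intros holomorphic_on_subset[OF H]) (use R in auto)
      fix z :: complex assume "z \<in> ball 0 R"
      then have "Re (H z) \<le> K / R\<^sup>2" using ReH by simp
      moreover have "- Re (H 0) \<le> \<bar>A1\<bar>"
        using a(2) d0 abs_Re_le_cmod[of "H 0"] by (simp add: H_def)
      moreover have "K / R\<^sup>2 \<le> \<bar>K\<bar> / R\<^sup>2" by (intro divide_right_mono) auto
      ultimately show "Re (H z - H 0) < A" by (simp add: A_def)
    qed (use R \<zeta> in auto)
    also have "2 * A * cmod \<zeta> \<le> 2 * A * R1"
      using \<zeta> R by (intro mult_left_mono) (auto simp: A_def)
    finally have "cmod (H \<zeta> - H 0) * (R - cmod \<zeta>) \<le> 2 * A * R1" .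
    moreover have "cmod (H \<zeta> - H 0) * (R - R1) \<le> cmod (H \<zeta> - H 0) * (R - cmod \<zeta>)"
      using \<zeta> by (intro mult_left_mono) auto
    ultimately have G: "cmod (H \<zeta> - H 0) \<le> G"
      using R by (simp add: G_def pos_le_divide_eq)
    have "\<psi> \<zeta> = (H \<zeta> - H 0) + deriv \<phi> 0 - \<zeta> * (cnj (\<phi> 0) / of_real (R\<^sup>2))"
      by (simp add: H_def d0)
    also have "cmod \<dots> \<le> cmod (H \<zeta> - H 0) + cmod (deriv \<phi> 0) + cmod (\<zeta> * (cnj (\<phi> 0) / of_real (R\<^sup>2)))"
      using norm_triangle_ineq4[of "(H \<zeta> - H 0) + deriv \<phi> 0" "\<zeta> * (cnj (\<phi> 0) / of_real (R\<^sup>2))"]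
        norm_triangle_ineq[of "H \<zeta> - H 0" "deriv \<phi> 0"] by linarith
    also have "cmod (\<zeta> * (cnj (\<phi> 0) / of_real (R\<^sup>2))) \<le> R1 * (A0 / R\<^sup>2)"
      unfolding norm_mult norm_divide norm_of_real complex_mod_cnj
      using \<zeta> a R by (intro mult_mono divide_mono) auto
    finally have "cmod (\<psi> \<zeta>) \<le> G + A1 + A0 * R1 / R\<^sup>2" using G a by (simp add: mult.commute)
    then have "cmod \<zeta> * cmod (\<psi> \<zeta>) \<le> R1 * (G + A1 + A0 * R1 / R\<^sup>2)"
      using \<zeta> R by (intro mult_mono) auto
    moreover have "\<phi> \<zeta> = \<phi> 0 + \<zeta> * \<psi> \<zeta>" using \<psi>(2)[of \<zeta>] \<zeta> R by (simp add: algebra_simps)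
    then have "cmod (\<phi> \<zeta>) \<le> cmod (\<phi> 0) + cmod \<zeta> * cmod (\<psi> \<zeta>)"
      using norm_triangle_ineq norm_mult by metis
    ultimately show ?thesis using a by (simp add: C_def)
  qed
  then show ?thesis using that by blast
qed

lemma root_of_unity_filter:
  obtains w :: complex where "cmod w = 1"
    "\<And>n. 0 < n \<Longrightarrow> n < N \<Longrightarrow> (\<Sum>k<N. (w ^ n) ^ k) = 0" "w ^ N = 1"
proof (cases "N = 0")
  case False
  define w where "w = cis (2 * pi / N)"
  have wn: "w ^ n = cis (2 * pi * n / N)" for n
  proof -
    have "real n * (2 * pi / N) = 2 * pi * n / N" by simp
    then show ?thesis unfolding w_def Complex.DeMoivre by (simp only:)
  qed
  have "2 * pi * N / N = 2 * pi" using False by simp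
  then have wN: "w ^ N = 1" unfolding wn by (simp only: cis_2pi)
  have "(\<Sum>k<N. (w ^ n) ^ k) = 0" if "0 < n" "n < N" for n
  proof -
    have "inj_on (\<lambda>k. cis (2 * pi * real k / real N)) {..<N}"
      by (rule bij_betw_imp_inj_on[OF Complex.bij_betw_roots_unity]) (use False in simp)
    from inj_onD[OF this, of n 0] that have "w ^ n \<noteq> 1"
      unfolding wn by force
    moreover have "(w ^ n) ^ N = (w ^ N) ^ n" by (simp only: power_mult[symmetric] mult.commute)
    then have "(w ^ n) ^ N = 1" using wN by simp
    ultimately show ?thesis by (simp add: geometric_sum)
  qed
  moreover have "cmod w = 1" by (simp add: w_def)
  ultimately show ?thesis using wN by (intro that)
next
  case True
  show ?thesis by (rule that[of 1]) (simp_all add: True)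
qed

text \<open>
  With \<open>m + 1\<close> roots of unity, \<open>w\<^sup>k\<close> is the character \<open>w ^
  (- m k)\<close>, so the average keeps exactly the Taylor coefficients whose index is congruent
  to \<open>m\<close>; the first of them is the \<open>m\<close>-th.
\<close>

lemma root_average:
  fixes \<phi> :: "complex \<Rightarrow> complex"
  assumes \<phi>: "\<phi> holomorphic_on ball 0 1" and R1: "0 < R1" "R1 < 1"
    and C: "\<And>\<zeta>. cmod \<zeta> \<le> R1 \<Longrightarrow> cmod (\<phi> \<zeta>) \<le> C"
    and w: "cmod w = 1" "w ^ Suc m = 1" "\<And>n. 0 < n \<Longrightarrow> n < Suc m \<Longrightarrow> (\<Sum>k<Suc m. (w ^ n) ^ k) = 0"
  defines "q \<equiv> \<lambda>\<zeta>. (1 / of_nat (Suc m)) * (\<Sum>k<Suc m. w ^ k * \<phi> (w ^ k * \<zeta>))"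
  shows "q holomorphic_on ball 0 1" "(deriv ^^ m) q 0 = (deriv ^^ m) \<phi> 0"
    "\<And>\<zeta>. cmod \<zeta> \<le> R1 / 2 \<Longrightarrow> cmod (q \<zeta>) \<le> 2 * C * (cmod \<zeta> / R1) ^ m"
proof -
  have wk: "w ^ k * \<zeta> \<in> ball 0 1" if "\<zeta> \<in> ball 0 1" for k \<zeta>
    using that w(1) by (simp add: norm_mult norm_power)
  have trm: "(\<lambda>\<zeta>. \<phi> (w ^ k * \<zeta>)) holomorphic_on ball 0 1" for k
  proof -
    have "(\<lambda>\<zeta>. w ^ k * \<zeta>) ` ball 0 1 \<subseteq> ball 0 1" using wk by auto
    moreover have "(\<lambda>\<zeta>. w ^ k * \<zeta>) holomorphic_on ball 0 1" by (intro holomorphic_intros)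
    ultimately show ?thesis using holomorphic_on_compose_gen[OF _ \<phi>] by (simp add: o_def)
  qed
  show hol: "q holomorphic_on ball 0 1"
    unfolding q_def by (intro holomorphic_intros trm)
  have hsum: "(deriv ^^ j) (\<lambda>\<zeta>. \<Sum>k<n. w ^ k * \<phi> (w ^ k * \<zeta>)) 0 = (\<Sum>k<n. (w ^ Suc j) ^ k) * (deriv ^^ j) \<phi> 0" for j n
  proof (induction n)
    case 0
    then show ?case by (cases j) (auto simp: higher_deriv_const)
  next
    case (Suc n)
    have "(deriv ^^ j) (\<lambda>\<zeta>. (\<Sum>k<n. w ^ k * \<phi> (w ^ k * \<zeta>)) + w ^ n * \<phi> (w ^ n * \<zeta>)) 0
        = (deriv ^^ j) (\<lambda>\<zeta>. \<Sum>k<n. w ^ k * \<phi> (w ^ k * \<zeta>)) 0 + (deriv ^^ j) (\<lambda>\<zeta>. w ^ n * \<phi> (w ^ n * \<zeta>)) 0"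
      by (rule higher_deriv_add[of _ "ball 0 1"]) (auto intro!: holomorphic_intros trm)
    also have "(deriv ^^ j) (\<lambda>\<zeta>. w ^ n * \<phi> (w ^ n * \<zeta>)) 0 = w ^ n * (deriv ^^ j) (\<lambda>\<zeta>. \<phi> (w ^ n * \<zeta>)) 0"
      by (rule higher_deriv_cmult[of _ "ball 0 1"]) (auto intro!: trm)
    also have "(deriv ^^ j) (\<lambda>\<zeta>. \<phi> (w ^ n * \<zeta>)) 0 = (w ^ n) ^ j * (deriv ^^ j) \<phi> (w ^ n * 0)"
      by (rule higher_deriv_compose_linear[OF \<phi> open_ball[of 0 1] open_ball]) (use wk in auto)
    also have "w ^ n * ((w ^ n) ^ j * (deriv ^^ j) \<phi> (w ^ n * 0)) = (w ^ Suc j) ^ n * (deriv ^^ j) \<phi> 0"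
      by (simp add: power_mult_distrib mult_ac flip: power_mult)
    finally show ?case by (simp add: Suc.IH distrib_right)
  qed
  \<comment> \<open>The factor by which averaging multiplies the coefficient of index
    \<open>j\<close>. The weight \<open>w ^ k\<close> raises the exponent to \<open>j + 1\<close>,
    so it vanishes for \<open>j < m\<close> and is 1 at \<open>j = m\<close>; beyond that only
    \<open>cmod (c j) \<le> 1\<close> is used.\<close>
  define c where "c j = (\<Sum>k<Suc m. (w ^ Suc j) ^ k) / of_nat (Suc m)" for j
  have dq: "(deriv ^^ j) q 0 = c j * (deriv ^^ j) \<phi> 0" for j
  proof -
    have "(deriv ^^ j) q 0 = (1 / of_nat (Suc m)) * (deriv ^^ j) (\<lambda>\<zeta>. \<Sum>k<Suc m. w ^ k * \<phi> (w ^ k * \<zeta>)) 0"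
      unfolding q_def
      by (rule higher_deriv_cmult[of _ "ball 0 1"]) (auto intro!: holomorphic_intros trm simp del: sum.lessThan_Suc)
    then show ?thesis unfolding hsum c_def by (simp add: field_simps)
  qed
  have c0: "c j = 0" if "j < m" for j using w(3)[of "Suc j"] that by (simp add: c_def del: sum.lessThan_Suc power_Suc)
  have "c m = 1" unfolding c_def w(2) by (simp del: sum.lessThan_Suc of_nat_Suc add: field_simps)
  then show "(deriv ^^ m) q 0 = (deriv ^^ m) \<phi> 0" using dq by simp
  have c1: "cmod (c j) \<le> 1" for j
  proof -
    have "cmod (\<Sum>k<Suc m. (w ^ Suc j) ^ k) \<le> (\<Sum>k<Suc m. 1)"
      by (rule sum_norm_le) (simp add: norm_power norm_mult w)
    then show ?thesis by (simp add: c_def norm_divide del: sum.lessThan_Suc of_nat_Suc power_Suc)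
  qed
  have C0: "C \<ge> 0" using order_trans[OF norm_ge_zero C[of 0]] R1 by simp
  have cauchy: "cmod ((deriv ^^ j) \<phi> 0) \<le> fact j * C / R1 ^ j" for j
  proof (rule Cauchy_inequality)
    show "\<phi> holomorphic_on ball 0 R1" by (rule holomorphic_on_subset[OF \<phi>]) (use R1 in auto)
    show "continuous_on (cball 0 R1) \<phi>"
      by (rule continuous_on_subset[OF holomorphic_on_imp_continuous_on[OF \<phi>]]) (use R1 in auto)
  qed (use R1 C in auto)
  fix \<zeta> :: complex assume \<zeta>: "cmod \<zeta> \<le> R1 / 2"
  define x where "x = cmod \<zeta> / R1"
  have x: "0 \<le> x" "x \<le> 1 / 2" using \<zeta> R1 by (auto simp: x_def field_simps)
  define f where "f j = (deriv ^^ j) q 0 / fact j * (\<zeta> - 0) ^ j" for j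
  have "f sums q \<zeta>"
    unfolding f_def by (rule holomorphic_power_series[OF hol]) (use \<zeta> R1 in auto)
  moreover have "(\<Sum>j<m. f j) = 0" by (rule sum.neutral) (simp add: f_def dq c0)
  ultimately have sums: "(\<lambda>j. f (j + m)) sums q \<zeta>"
    using sums_iff_shift[of f m "q \<zeta>"] by simp
  have fb: "cmod (f j) \<le> C * x ^ j" for j
  proof -
    have "cmod (f j) = cmod (c j) * (cmod ((deriv ^^ j) \<phi> 0) / fact j) * cmod \<zeta> ^ j"
      by (simp add: f_def dq norm_mult norm_divide norm_power)
    also have "\<dots> \<le> 1 * (C / R1 ^ j) * cmod \<zeta> ^ j"
      using c1[of j] cauchy[of j] C0 R1 by (intro mult_right_mono mult_mono) (auto simp: field_simps)
    finally show ?thesis by (simp add: x_def power_divide)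
  qed
  have "(\<lambda>j. C * x ^ m * x ^ j) sums (C * x ^ m * (1 / (1 - x)))"
    using x by (intro sums_mult geometric_sums) auto
  moreover have "cmod (f (j + m)) \<le> C * x ^ m * x ^ j" for j
    using fb[of "j + m"] by (simp add: power_add mult_ac)
  ultimately have "cmod (q \<zeta>) \<le> C * x ^ m * (1 / (1 - x))"
    using norm_suminf_le[of "\<lambda>j. f (j + m)" "\<lambda>j. C * x ^ m * x ^ j"] sums by (simp add: sums_iff)
  \<comment> \<open>The restriction to \<open>R1 / 2\<close> is what bounds the geometric series by
    2.\<close>
  also have "\<dots> \<le> C * x ^ m * 2" using x C0 by (intro mult_left_mono) (auto simp: field_simps)
  finally show "cmod (q \<zeta>) \<le> 2 * C * (cmod \<zeta> / R1) ^ m" by (simp add: x_def mult_ac)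
qed

section \<open>Boundedness of dissipative maps on smaller balls\<close>

text \<open>Conjugate homogeneity carries one functional along a whole complex line; this is the
  source of the factor \<open>cnj \<zeta>\<close> in the boundary condition of the one-variable
  estimate.\<close>

lemma duality_map_scaleC:
  assumes "l \<in> duality_map z"
  shows "(\<lambda>y. cnj c * l y) \<in> duality_map (c *\<^sub>C z)"
proof -
  have l: "l \<in> cdual" "\<And>w. cmod (l w) \<le> norm z * norm w" "l z = complex_of_real ((norm z)\<^sup>2)"
    using assms by (simp_all add: duality_map_iff)
  show ?thesis
    unfolding duality_map_iff
  proof (intro conjI allI)
    show "(\<lambda>y. cnj c * l y) \<in> cdual"
      using l(1) unfolding cdual_def bounded_clinear_def scaleC_complex_def
      by (auto simp: bounded_linear_const_mult)
    show "cmod (cnj c * l y) \<le> norm (c *\<^sub>C z) * norm y" for y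
      using mult_left_mono[OF l(2)[of y], of "cmod c"] by (simp add: norm_mult norm_scaleC mult.assoc)
    have "cnj c * l (c *\<^sub>C z) = (c * cnj c) * l z"
      by (simp add: cdualD[OF l(1)])
    also have "\<dots> = complex_of_real ((norm (c *\<^sub>C z))\<^sup>2)"
      by (simp add: l(3) norm_scaleC power_mult_distrib complex_norm_square[symmetric])
    finally show "cnj c * l (c *\<^sub>C z) = complex_of_real ((norm (c *\<^sub>C z))\<^sup>2)" .
  qed
qed

lemma dissipative_numerical_bound:
  fixes h :: "'a::complex_normed_vector \<Rightarrow> 'a"
  assumes h: "h \<in> Hol unit_ball UNIV" and diss: "dissipative \<omega> h" and \<rho>: "\<rho> < 1"
  obtains C where "\<And>z l. norm z \<le> \<rho> \<Longrightarrow> l \<in> duality_map z \<Longrightarrow> cmod (l (h z)) \<le> C * norm z"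
proof -
  obtain \<epsilon> \<sigma> where \<epsilon>: "\<epsilon> > 0" and d: "\<And>x f. 1 - \<epsilon> < norm x \<Longrightarrow> norm x < 1 \<Longrightarrow> f \<in> duality_map x \<Longrightarrow>
      Re (f (h x)) \<le> \<omega> * (norm x)\<^sup>2 + \<sigma> * (1 - (norm x)\<^sup>2)"
    using diss unfolding dissipative_def by force
  define R1 where "R1 = max \<rho> 0"
  \<comment> \<open>A circle outside radius \<open>R1\<close> but inside the shell where
    dissipativity is assumed.\<close>
  define R where "R = max ((1 + R1) / 2) (1 - \<epsilon> / 2)"
  have R1: "0 \<le> R1" "R1 < 1" "\<rho> \<le> R1" using \<rho> by (auto simp: R1_def)
  have "(1 + R1) / 2 \<le> R" "1 - \<epsilon> / 2 \<le> R" "R < 1" using R1 \<epsilon> by (auto simp: R_def)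
  then have R: "0 < R" "R < 1" "0 \<le> R1" "R1 < R" "1 - \<epsilon> < R" "\<rho> \<le> R1"
    using R1 \<epsilon> by auto
  obtain h' where h': "(h has_derivative h') (at 0)" using HolE[OF h, of 0] by auto
  obtain C where C: "\<And>\<phi> \<zeta>. \<lbrakk>\<phi> holomorphic_on ball 0 1; \<And>\<zeta>. cmod \<zeta> = R \<Longrightarrow> Re (cnj \<zeta> * \<phi> \<zeta>) \<le> \<bar>\<omega>\<bar> + \<bar>\<sigma>\<bar>;
    cmod (\<phi> 0) \<le> norm (h 0); cmod (deriv \<phi> 0) \<le> onorm h'; cmod \<zeta> \<le> R1\<rbrakk> \<Longrightarrow> cmod (\<phi> \<zeta>) \<le> C"
    using bounded_of_boundary_real_part[OF R(1-4)] by blast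
  have K: "\<omega> * R\<^sup>2 + \<sigma> * (1 - R\<^sup>2) \<le> \<bar>\<omega>\<bar> + \<bar>\<sigma>\<bar>"
  proof -
    have "R\<^sup>2 \<le> 1" using R by (simp add: power_le_one)
    then have "\<bar>\<omega> * R\<^sup>2\<bar> \<le> \<bar>\<omega>\<bar>" "\<bar>\<sigma> * (1 - R\<^sup>2)\<bar> \<le> \<bar>\<sigma>\<bar>"
      by (auto simp: abs_mult intro!: mult_left_le)
    then show ?thesis by linarith
  qed
  have "cmod (l (h z)) \<le> C * norm z" if z: "norm z \<le> \<rho>" and l: "l \<in> duality_map z" for z l
  proof (cases "z = 0")
    case True
    then show ?thesis using l by (auto simp: duality_map_iff dest: spec[of _ "h z"])
  next
    case False
    define c where "c = complex_of_real (1 / norm z)"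
    define v where "v = c *\<^sub>C z"
    define l' where "l' y = cnj c * l y" for y
    have l': "l' \<in> duality_map v"
      unfolding l'_def v_def by (rule duality_map_scaleC[OF l])
    have nv: "norm v = 1" using False by (simp add: v_def c_def norm_scaleC norm_divide)
    have l'c: "l' \<in> cdual" and l'b: "cmod (l' y) \<le> norm y" for y
      using l' nv by (auto simp: duality_map_iff)
    have "cmod (l' (h (0 + of_real (norm z) *\<^sub>C v))) \<le> C"
    proof (rule C[of "\<lambda>\<zeta>. l' (h (0 + \<zeta> *\<^sub>C v))"])
      show "(\<lambda>\<zeta>. l' (h (0 + \<zeta> *\<^sub>C v))) holomorphic_on ball 0 1"
        by (rule cdual_Hol_line_holomorphic[OF h l'c]) (simp add: norm_scaleC nv)
      show "cmod (l' (h (0 + 0 *\<^sub>C v))) \<le> norm (h 0)" using l'b by simp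
      have "deriv (\<lambda>\<zeta>. l' (h (0 + \<zeta> *\<^sub>C v))) 0 = l' (h' v)"
        by (rule DERIV_imp_deriv[OF cdual_Hol_line_deriv[OF h _ h' l'c]]) simp
      then show "cmod (deriv (\<lambda>\<zeta>. l' (h (0 + \<zeta> *\<^sub>C v))) 0) \<le> onorm h'"
        using l'b[of "h' v"] onorm[OF has_derivative_bounded_linear[OF h'], of v] nv by simp
      show "cmod (of_real (norm z)) \<le> R1" using z R by simp
      fix \<zeta> :: complex assume \<zeta>: "cmod \<zeta> = R"
      have "Re (cnj \<zeta> * l' (h (\<zeta> *\<^sub>C v))) \<le> \<omega> * (norm (\<zeta> *\<^sub>C v))\<^sup>2 + \<sigma> * (1 - (norm (\<zeta> *\<^sub>C v))\<^sup>2)"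
        by (rule d[OF _ _ duality_map_scaleC[OF l']]) (use R \<zeta> nv in \<open>auto simp: norm_scaleC\<close>)
      then show "Re (cnj \<zeta> * l' (h (0 + \<zeta> *\<^sub>C v))) \<le> \<bar>\<omega>\<bar> + \<bar>\<sigma>\<bar>"
        using K by (simp add: norm_scaleC nv \<zeta>)
    qed
    moreover have "of_real (norm z) *\<^sub>C v = z"
      using False by (simp add: v_def c_def scaleC_scaleC)
    ultimately have "cmod (l (h z)) / norm z \<le> C"
      by (simp add: l'_def c_def norm_mult norm_divide)
    then show ?thesis using False by (simp add: field_simps)
  qed
  then show ?thesis using that by blast
qed

text \<open>The functional norming \<open>h z\<close> need not belong to the duality map of
  \<open>z\<close>, so coefficients of \<open>h\<close> along lines must be bounded for arbitrary
  functionals of norm at most 1. For each \<open>m\<close> the average \<open>Q\<close> has the same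
  \<open>m\<close>-th coefficient as \<open>h\<close> and a small numerical range near 0, which
  \<open>norm_le_of_numerical_bound\<close> converts into a norm bound.\<close>

lemma bounded_of_numerical_bound:
  fixes h :: "'a::complex_banach \<Rightarrow> 'a"
  assumes h: "h \<in> Hol unit_ball UNIV"
    and num: "\<And>r. r < 1 \<Longrightarrow> \<exists>C. \<forall>z l. norm z \<le> r \<longrightarrow> l \<in> duality_map z \<longrightarrow> cmod (l (h z)) \<le> C * norm z"
    and \<rho>: "\<rho> < 1"
  obtains M where "\<And>z. norm z \<le> \<rho> \<Longrightarrow> norm (h z) \<le> M"
proof -
  define R2 where "R2 = max \<rho> 0"
  \<comment> \<open>Close enough to 1 for \<open>R2 < \<theta> * \<theta>\<close>, the condition
    under which the coefficient bounds sum at radius \<open>R2\<close>.\<close>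
  define \<theta> where "\<theta> = 1 - (1 - R2) / 3"
  have R2: "0 \<le> R2" "R2 < 1" "\<rho> \<le> R2" using \<rho> by (auto simp: R2_def)
  have \<theta>: "0 < \<theta>" "\<theta> < 1" using R2 by (auto simp: \<theta>_def)
  have "\<theta> * \<theta> - R2 = (1 - R2) / 3 + ((1 - R2) / 3)\<^sup>2"
    by (simp add: \<theta>_def power2_eq_square field_simps)
  moreover have "0 < (1 - R2) / 3" using R2 by simp
  ultimately have \<theta>2: "R2 < \<theta> * \<theta>" using zero_le_power2[of "(1 - R2) / 3"] by linarith
  obtain C0 where C0: "\<And>z l. norm z \<le> \<theta> \<Longrightarrow> l \<in> duality_map z \<Longrightarrow> cmod (l (h z)) \<le> C0 * norm z"
    using num[OF \<theta>(2)] by blast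
  \<comment> \<open>The numerical bound, divided by the norm of the point, says nothing at the
    origin; hence the summand \<open>norm (h 0)\<close>.\<close>
  define C where "C = \<bar>C0\<bar> + norm (h 0) + 1"
  have C: "C > 0" "norm (h 0) \<le> C" by (auto simp: C_def add_nonneg_pos)
  have num: "cmod (l (h z)) \<le> C * norm z" if "norm z \<le> \<theta>" "l \<in> duality_map z" for z l
  proof -
    have "C0 \<le> C" unfolding C_def using abs_ge_self[of C0] norm_ge_zero[of "h 0"] by linarith
    then have "C0 * norm z \<le> C * norm z" by (intro mult_right_mono) auto
    then show ?thesis using C0[OF that] by simp
  qed
  have "isCont h 0" using Hol_continuous[OF h] by simp
  then obtain s0 where s0: "s0 > 0" "\<And>z. dist z 0 < s0 \<Longrightarrow> dist (h z) (h 0) < 1"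
    unfolding continuous_at_eps_delta by (metis zero_less_one)
  \<comment> \<open>\<open>s0\<close> is the radius of the local bound, and
    \<open>\<theta> / 2\<close> the range of \<open>root_average\<close>.\<close>
  define s where "s = min s0 (\<theta> / 2)"
  have s: "0 < s" "s \<le> s0" "s \<le> \<theta> / 2" "s \<le> 1" using s0 \<theta> by (auto simp: s_def)
  have M0: "norm (h z) \<le> norm (h 0) + 1" if "norm z < s" for z
    using s0(2)[of z] that s norm_triangle_ineq2[of "h z" "h 0"] by (simp add: dist_norm)
  define D where "D = 4 * C / (1 - \<theta>)"
  have D: "D > 0" using C \<theta> by (simp add: D_def)
  have coeff: "cmod ((deriv ^^ m) (\<lambda>\<zeta>. l (h (0 + \<zeta> *\<^sub>C v))) 0) \<le> fact m * D / (\<theta> * \<theta>) ^ m"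
    if v: "norm v = 1" and l: "l \<in> cdual" "\<And>y. cmod (l y) \<le> norm y" for v l m
  proof -
    obtain w where w: "cmod w = 1" "\<And>n. 0 < n \<Longrightarrow> n < Suc m \<Longrightarrow> (\<Sum>k<Suc m. (w ^ n) ^ k) = 0" "w ^ Suc m = 1"
      using root_of_unity_filter[of "Suc m"] by blast
    define Q where "Q z = (1 / of_nat (Suc m)) *\<^sub>C (\<Sum>k<Suc m. w ^ k *\<^sub>C h (w ^ k *\<^sub>C z))" for z
    have nw: "norm (w ^ k *\<^sub>C z) = norm z" for k and z :: 'a by (simp add: norm_scaleC norm_power w(1))
    have lQ: "f (Q (\<zeta> *\<^sub>C u)) = (1 / of_nat (Suc m)) * (\<Sum>k<Suc m. w ^ k * f (h (0 + (w ^ k * \<zeta>) *\<^sub>C u)))"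
      if f: "f \<in> cdual" for f \<zeta> u
      unfolding Q_def cdualD(2)[OF f] linear_sum[OF bounded_linear.linear[OF cdualD(1)[OF f]]]
      by (simp only: scaleC_scaleC add_0)
    have trm: "(\<lambda>z. w ^ k *\<^sub>C h (w ^ k *\<^sub>C z)) \<in> Hol (ball 0 s) UNIV" for k
    proof (rule Hol_cmult[OF Hol_compose[OF _ h]])
      show "(\<lambda>z::'a. w ^ k *\<^sub>C z) \<in> Hol (ball 0 s) unit_ball"
      proof (rule Hol_mono[OF Hol_bounded_clinear[OF bounded_clinear_scaleC] order_refl])
        fix z :: 'a assume "z \<in> ball 0 s"
        then show "w ^ k *\<^sub>C z \<in> unit_ball" using nw[of k z] s by simp
      qed
    qed
    have QH: "Q \<in> Hol (ball 0 s) UNIV"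
      unfolding Q_def by (rule Hol_cmult[OF Hol_sum]) (use trm in auto)
    have Qb: "norm (Q z) \<le> norm (h 0) + 1" if "z \<in> ball 0 s" for z
    proof -
      have "norm (\<Sum>k<Suc m. w ^ k *\<^sub>C h (w ^ k *\<^sub>C z)) \<le> of_nat (card {..<Suc m}) * (norm (h 0) + 1)"
        by (rule sum_norm_bound) (use M0 nw that in simp)
      then show ?thesis
        by (simp add: Q_def norm_scaleC norm_divide field_simps del: sum.lessThan_Suc of_nat_Suc)
    qed
    have hol: "(\<lambda>\<zeta>. f (h (0 + \<zeta> *\<^sub>C u))) holomorphic_on ball 0 1" if "f \<in> cdual" "norm u = 1" for f u
      by (rule cdual_Hol_line_holomorphic[OF h that(1)]) (simp add: norm_scaleC that)
    define W where "W = 2 * C * (s / \<theta>) ^ m"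
    have W: "W > 0" using C s \<theta> by (simp add: W_def)
    have Qnum: "cmod (f (Q z)) \<le> W * norm z" if z: "z \<in> ball 0 s" and f: "f \<in> duality_map z" for z f
    proof (cases "z = 0")
      case True
      then show ?thesis using f by (auto simp: duality_map_iff dest: spec[of _ "Q z"])
    next
      case False
      define c where "c = complex_of_real (1 / norm z)"
      define u where "u = c *\<^sub>C z"
      define f' where "f' y = cnj c * f y" for y
      have f': "f' \<in> duality_map u"
        unfolding f'_def u_def by (rule duality_map_scaleC[OF f])
      have nu: "norm u = 1" using False by (simp add: u_def c_def norm_scaleC norm_divide)
      have f'c: "f' \<in> cdual" using f' by (auto simp: duality_map_iff)
      have zu: "of_real (norm z) *\<^sub>C u = z"
        using False by (simp add: u_def c_def scaleC_scaleC)
      define \<phi> where "\<phi> \<zeta> = f' (h (0 + \<zeta> *\<^sub>C u))" for \<zeta>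
      have \<phi>C: "cmod (\<phi> \<zeta>) \<le> C" if "cmod \<zeta> \<le> \<theta>" for \<zeta>
      proof (cases "\<zeta> = 0")
        case True
        have "cmod (f' (h 0)) \<le> norm (h 0)" using f' nu by (auto simp: duality_map_iff)
        then show ?thesis using C True by (simp add: \<phi>_def)
      next
        case nz: False
        have "cmod (cnj \<zeta> * f' (h (\<zeta> *\<^sub>C u))) \<le> C * norm (\<zeta> *\<^sub>C u)"
          by (rule num[OF _ duality_map_scaleC[OF f']]) (simp add: norm_scaleC nu that)
        then show ?thesis using nz by (simp add: \<phi>_def norm_mult norm_scaleC nu)
      qed
      have "cmod (f' (Q (of_real (norm z) *\<^sub>C u))) \<le> 2 * C * (cmod (of_real (norm z)) / \<theta>) ^ m"
        unfolding lQ[OF f'c] \<phi>_def[symmetric]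
        by (rule root_average(3)[OF hol[OF f'c nu, folded \<phi>_def] \<theta> \<phi>C w(1,3,2)]) (use z s in auto)
      also have "\<dots> \<le> W"
        unfolding W_def using C z \<theta> by (intro mult_left_mono power_mono divide_right_mono) auto
      finally have "cmod (f (Q z)) / norm z \<le> W"
        unfolding zu by (simp add: f'_def c_def norm_mult norm_divide)
      then show ?thesis using False by (simp add: field_simps)
    qed
    \<comment> \<open>\<open>T * W\<close> is half of the gap between the radii
      \<open>\<theta> * s\<close> and \<open>s\<close>; this also fixes the value of
      \<open>D\<close>, through \<open>s / T = D * (s / \<theta>) ^ m\<close>.\<close>
    define T where "T = (1 - \<theta>) * s / (2 * W)"
    have T: "T > 0" "T * W = (1 - \<theta>) * s / 2" using W \<theta> s by (auto simp: T_def)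
    have sT: "s / T = D * (s / \<theta>) ^ m"
      using W s \<theta> by (simp add: T_def D_def W_def field_simps)
    have Qw: "norm (Q x) \<le> D * (s / \<theta>) ^ m" if x: "norm x \<le> \<theta> * s" for x
      unfolding sT[symmetric]
    proof (rule norm_le_of_numerical_bound[OF QH s(4)])
      have "0 < (1 - \<theta>) * s" using \<theta> s by simp
      then show "T * W + norm x < s" using x T(2) by (simp add: algebra_simps)
      show "norm (Q z) \<le> norm (h 0) + 1" if "z \<in> ball 0 s" for z by (rule Qb[OF that])
      show "cmod (f (Q z)) \<le> W * norm z" if "z \<in> ball 0 s" "f \<in> duality_map z" for z f
        by (rule Qnum[OF that])
    qed (use T W in auto)
    define q where "q \<zeta> = l (Q (\<zeta> *\<^sub>C v))" for \<zeta>
    define \<phi> where "\<phi> \<zeta> = l (h (0 + \<zeta> *\<^sub>C v))" for \<zeta>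
    have q: "q = (\<lambda>\<zeta>. (1 / of_nat (Suc m)) * (\<Sum>k<Suc m. w ^ k * \<phi> (w ^ k * \<zeta>)))"
      unfolding q_def \<phi>_def lQ[OF l(1)] ..
    \<comment> \<open>Here \<open>l\<close> is arbitrary, so the numerical bound gives nothing and
      compactness supplies a bound. Its size is irrelevant: only holomorphy of \<open>q\<close> and
      its \<open>m\<close>-th coefficient are drawn from it.\<close>
    obtain Cl where Cl: "\<And>\<zeta>. cmod \<zeta> \<le> \<theta> \<Longrightarrow> cmod (\<phi> \<zeta>) \<le> Cl"
    proof -
      have "compact (\<phi> ` cball 0 \<theta>)"
        by (intro compact_continuous_image compact_cball continuous_on_subset[OF
              holomorphic_on_imp_continuous_on[OF hol[OF l(1) v, folded \<phi>_def]]]) (use \<theta> in auto)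
      then obtain B where "\<And>y. y \<in> \<phi> ` cball 0 \<theta> \<Longrightarrow> cmod y \<le> B"
        using compact_imp_bounded bounded_iff by metis
      then show ?thesis using that[of B] by auto
    qed
    have qhol: "q holomorphic_on ball 0 1" and qd: "(deriv ^^ m) q 0 = (deriv ^^ m) \<phi> 0"
      using root_average(1,2)[OF hol[OF l(1) v, folded \<phi>_def] \<theta> Cl w(1,3,2)] unfolding q by blast+
    have "cmod ((deriv ^^ m) q 0) \<le> fact m * (D * (s / \<theta>) ^ m) / (\<theta> * s) ^ m"
    proof (rule Cauchy_inequality)
      have small: "\<theta> * s < 1" using \<theta> s mult_strict_mono[of \<theta> 1 s 1] by (smt (verit) mult_left_le)
      show "q holomorphic_on ball 0 (\<theta> * s)" by (rule holomorphic_on_subset[OF qhol]) (use small in auto)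
      show "continuous_on (cball 0 (\<theta> * s)) q"
        by (rule continuous_on_subset[OF holomorphic_on_imp_continuous_on[OF qhol]]) (use small in auto)
      show "0 < \<theta> * s" using \<theta> s by simp
      fix \<zeta> :: complex assume "cmod (0 - \<zeta>) = \<theta> * s"
      then have "norm (Q (\<zeta> *\<^sub>C v)) \<le> D * (s / \<theta>) ^ m" by (intro Qw) (simp add: norm_scaleC v)
      then show "cmod (q \<zeta>) \<le> D * (s / \<theta>) ^ m" using l(2)[of "Q (\<zeta> *\<^sub>C v)"] by (simp add: q_def)
    qed
    also have "\<dots> = fact m * D / (\<theta> * \<theta>) ^ m"
      using s \<theta> by (simp add: power_divide power_mult_distrib)
    finally show ?thesis unfolding qd \<phi>_def .
  qed
  have "norm (h z) \<le> max (norm (h 0)) (D * (1 / (1 - R2 / (\<theta> * \<theta>))))" if z: "norm z \<le> \<rho>" for z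
  proof (cases "z = 0")
    case False
    define v where "v = complex_of_real (1 / norm z) *\<^sub>C z"
    have v: "norm v = 1" "of_real (norm z) *\<^sub>C v = z"
      using False by (auto simp: v_def norm_scaleC norm_divide scaleC_scaleC)
    obtain l where l: "l \<in> cdual" "\<And>y. cmod (l y) \<le> norm y" "l (h z) = complex_of_real (norm (h z))"
      using complex_norming_functional by blast
    define \<phi> where "\<phi> \<zeta> = l (h (0 + \<zeta> *\<^sub>C v))" for \<zeta>
    have hol: "\<phi> holomorphic_on ball 0 1"
      unfolding \<phi>_def by (rule cdual_Hol_line_holomorphic[OF h l(1)]) (simp add: norm_scaleC v)
    define x where "x = norm z / (\<theta> * \<theta>)"
    have x: "0 \<le> x" "x \<le> R2 / (\<theta> * \<theta>)" "R2 / (\<theta> * \<theta>) < 1"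
      using z R2 \<theta> \<theta>2 by (auto simp: x_def divide_right_mono)
    define f where "f m = (deriv ^^ m) \<phi> 0 / fact m * (of_real (norm z) - 0) ^ m" for m
    have sums: "f sums \<phi> (of_real (norm z))"
      unfolding f_def by (rule holomorphic_power_series[OF hol]) (use z R2 in auto)
    have fb: "cmod (f m) \<le> D * x ^ m" for m
    proof -
      have "cmod (f m) = cmod ((deriv ^^ m) \<phi> 0) / fact m * norm z ^ m"
        by (simp add: f_def norm_mult norm_divide norm_power)
      also have "\<dots> \<le> D / (\<theta> * \<theta>) ^ m * norm z ^ m"
        using coeff[OF v(1) l(1,2), of m] unfolding \<phi>_def[symmetric]
        by (intro mult_right_mono) (auto simp: field_simps)
      finally show ?thesis by (simp add: x_def power_divide)
    qed
    have "(\<lambda>m. D * x ^ m) sums (D * (1 / (1 - x)))"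
      using x by (intro sums_mult geometric_sums) auto
    then have "cmod (\<phi> (of_real (norm z))) \<le> D * (1 / (1 - x))"
      using norm_suminf_le[of f "\<lambda>m. D * x ^ m"] fb sums by (simp add: sums_iff)
    also have "\<dots> \<le> D * (1 / (1 - R2 / (\<theta> * \<theta>)))"
      using x D by (intro mult_left_mono divide_left_mono) auto
    finally show ?thesis by (simp add: \<phi>_def v l(3))
  qed auto
  then show ?thesis using that by blast
qed

section \<open>Dissipativity and Abel averages\<close>

text \<open>The Moebius-transformed Schwarz lemma compares \<open>u s\<close> and \<open>u 0\<close>
  as points; the pseudo-hyperbolic distance only decreases when both are replaced by their moduli,
  which leaves an inequality between real numbers.\<close>

lemma Schwarz_Pick_norm:
  assumes u: "u holomorphic_on ball 0 1" and u1: "\<And>z. cmod z < 1 \<Longrightarrow> cmod (u z) < 1"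
    and s: "cmod s < 1"
  shows "cmod (u s) - cmod s \<le> cmod (u 0) * (1 - (cmod s)\<^sup>2)"
proof -
  define a b where "a = u 0" and "b = u s"
  have ab: "cmod a < 1" "cmod b < 1" using u1 s by (auto simp: a_def b_def)
  define M where "M z = Moebius_function 0 a (u z)" for z
  have "cmod (M s) \<le> cmod s"
  proof (rule Schwarz_Lemma(1))
    have "u ` ball 0 1 \<subseteq> ball 0 1" using u1 by auto
    then show "M holomorphic_on ball 0 1"
      using holomorphic_on_compose_gen[OF u Moebius_function_holomorphic[OF ab(1)]]
      by (simp add: M_def[abs_def] o_def)
    show "M 0 = 0" by (simp add: M_def a_def Moebius_function_eq_zero)
    show "cmod (M z) < 1" if "cmod z < 1" for z
      unfolding M_def by (rule Moebius_function_norm_lt_1[OF ab(1) u1[OF that]])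
  qed (rule s)
  moreover have pos: "0 < cmod (1 - cnj a * b)"
  proof -
    have "cmod (cnj a * b) < 1"
      using mult_strict_mono[of "cmod a" 1 "cmod b" 1] ab by (simp add: norm_mult)
    then have "1 \<noteq> cnj a * b" by auto
    then show ?thesis by simp
  qed
  ultimately have 1: "cmod (b - a) \<le> cmod s * cmod (1 - cnj a * b)"
    by (simp add: M_def Moebius_function_simple b_def[symmetric] norm_divide pos_divide_le_eq)
  define p c where "p = cmod a * cmod b" and "c = Re (cnj a * b)"
  have "c \<le> p" using complex_Re_le_cmod[of "cnj a * b"] by (simp add: p_def c_def norm_mult)
  have p1: "p < 1" using mult_strict_mono[of "cmod a" 1 "cmod b" 1] ab by (simp add: p_def)
  have sq: "(cmod (b - a))\<^sup>2 = (cmod a)\<^sup>2 + (cmod b)\<^sup>2 - 2 * c" "(cmod (1 - cnj a * b))\<^sup>2 = 1 - 2 * c + p\<^sup>2"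
    unfolding c_def p_def power_mult_distrib
    by (simp_all add: cmod_power2, simp_all add: power2_eq_square algebra_simps)
  have "(cmod b - cmod a) * cmod (1 - cnj a * b) \<le> cmod (b - a) * (1 - p)"
  proof (rule power2_le_imp_le)
    \<comment> \<open>The factorisation exhibits the loss in passing to moduli: it vanishes exactly
      with \<open>p - c\<close>, that is, when \<open>cnj a * b\<close> is real and
      nonnegative.\<close>
    have "(cmod (b - a) * (1 - p))\<^sup>2 - ((cmod b - cmod a) * cmod (1 - cnj a * b))\<^sup>2
        = 2 * (p - c) * (1 - (cmod a)\<^sup>2) * (1 - (cmod b)\<^sup>2)"
      unfolding power_mult_distrib sq p_def by algebra
    also have "\<dots> \<ge> 0"
      using \<open>c \<le> p\<close> ab by (intro mult_nonneg_nonneg) (auto simp: power_le_one)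
    finally show "((cmod b - cmod a) * cmod (1 - cnj a * b))\<^sup>2 \<le> (cmod (b - a) * (1 - p))\<^sup>2" by simp
  qed (use p1 in simp)
  also have "\<dots> \<le> cmod s * cmod (1 - cnj a * b) * (1 - p)"
    using 1 p1 by (intro mult_right_mono) auto
  finally have "(cmod b - cmod a) * cmod (1 - cnj a * b) \<le> (cmod s * (1 - p)) * cmod (1 - cnj a * b)"
    by (simp add: mult_ac)
  then have "cmod b - cmod a \<le> cmod s * (1 - p)" using pos by (simp only: mult_le_cancel_right_pos)
  then have 2: "(cmod b - cmod s) * (1 + cmod s * cmod a) \<le> cmod a * (1 - (cmod s)\<^sup>2)"
    by (simp add: p_def power2_eq_square algebra_simps)
  have "cmod b - cmod s \<le> cmod a * (1 - (cmod s)\<^sup>2)"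
  proof (cases "cmod b \<le> cmod s")
    case True
    moreover have "0 \<le> cmod a * (1 - (cmod s)\<^sup>2)" using s by (simp add: power_le_one)
    ultimately show ?thesis by linarith
  next
    case False
    then have "cmod b - cmod s \<le> (cmod b - cmod s) * (1 + cmod s * cmod a)"
      by (simp add: mult_le_cancel_left1)
    then show ?thesis using 2 by linarith
  qed
  then show ?thesis by (simp add: a_def b_def)
qed

text \<open>Letting \<alpha> tend to 0 requires that \<open>\<Phi> \<alpha> x\<close> tends to
  \<open>x\<close>. The Banach fixed point theorem on a small ball around \<open>x\<close> produces
  a solution at distance at most \<open>\<alpha> * K\<close>, and uniqueness in the unit ball
  identifies it with \<open>\<Phi> \<alpha> x\<close>.\<close>

lemma pseudo_contractive_imp_dissipative:
  fixes h :: "'a::complex_banach \<Rightarrow> 'a"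
  assumes h: "h \<in> Hol unit_ball UNIV" and pc: "pseudo_contractive \<omega> h"
  shows "dissipative \<omega> h"
proof -
  obtain \<delta> where \<delta>: "\<delta> > 0" "\<And>\<alpha>. 0 < \<alpha> \<Longrightarrow> \<alpha> < \<delta> \<Longrightarrow> abel_average_in_Hol \<omega> h \<alpha>"
    using pc unfolding pseudo_contractive_def by blast
  define \<Phi> where "\<Phi> = abel_average \<omega> h"
  have \<Phi>: "\<Phi> \<alpha> \<in> Hol unit_ball unit_ball"
    "\<And>x y. x \<in> unit_ball \<Longrightarrow> y \<in> unit_ball \<Longrightarrow> abel_eq \<omega> h \<alpha> x y \<longleftrightarrow> y = \<Phi> \<alpha> x"
    if "0 < \<alpha>" "\<alpha> < \<delta>" for \<alpha>
  proof -
    have A: "abel_average_in_Hol \<omega> h \<alpha>" by (rule \<delta>(2)[OF that])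
    then show "\<Phi> \<alpha> \<in> Hol unit_ball unit_ball" by (simp add: abel_average_in_Hol_def \<Phi>_def)
    fix x y :: 'a assume x: "x \<in> unit_ball" and y: "y \<in> unit_ball"
    have ex: "\<exists>!y. y \<in> unit_ball \<and> abel_eq \<omega> h \<alpha> x y"
      using A x unfolding abel_average_in_Hol_def by blast
    show "abel_eq \<omega> h \<alpha> x y \<longleftrightarrow> y = \<Phi> \<alpha> x"
      using theI'[OF ex] the1_equality[OF ex] y unfolding \<Phi>_def abel_average_def by blast
  qed
  have lim: "((\<lambda>\<alpha>. \<Phi> \<alpha> x) \<longlongrightarrow> x) (at_right 0)" if x: "x \<in> unit_ball" for x
  proof -
    have "isCont h x" using Hol_continuous[OF h x] .
    then obtain d0 where d0: "d0 > 0" "\<And>z. dist z x < d0 \<Longrightarrow> dist (h z) (h x) < 1"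
      unfolding continuous_at_eps_delta by (metis zero_less_one)
    define d where "d = min d0 (1 - norm x) / 2"
    have d: "d > 0" "2 * d \<le> d0" "2 * d \<le> 1 - norm x" using d0 x by (auto simp: d_def)
    define M where "M = norm (h x) + 1"
    have M: "M > 0" "\<And>z. z \<in> ball x (2 * d) \<Longrightarrow> norm (h z) \<le> M"
    proof -
      show "M > 0" unfolding M_def using norm_ge_zero[of "h x"] by linarith
      fix z assume "z \<in> ball x (2 * d)"
      then have "dist (h z) (h x) < 1" using d0(2)[of z] d by (simp add: dist_commute)
      then show "norm (h z) \<le> M"
        using norm_triangle_ineq2[of "h z" "h x"] by (simp add: M_def dist_norm)
    qed
    have sub: "ball x (2 * d) \<subseteq> unit_ball" by (rule ball_subset_ball_dist) (use d in simp)
    have csub: "cball x d \<subseteq> ball x (2 * d)" using d by auto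
    have hd: "h \<in> Hol (ball x (2 * d)) UNIV" using Hol_mono[OF h sub] by simp
    have lip: "norm (h y - h z) \<le> M / d * norm (y - z)" if "y \<in> cball x d" "z \<in> cball x d" for y z
      using Hol_Lipschitz[OF hd _ M(2) that] d by simp
    define K where "K = M + \<bar>\<omega>\<bar> + 1"
    have K: "K > 0" "M < K" using M by (auto simp: K_def)
    have est: "dist (\<Phi> \<alpha> x) x \<le> \<alpha> * K" if \<alpha>: "0 < \<alpha>" "\<alpha> < min \<delta> (d / K)" for \<alpha>
    proof -
      have \<alpha>K: "\<alpha> * K < d" using \<alpha> K by (simp add: pos_less_divide_eq)
      define T where "T y = \<alpha> *\<^sub>R h y + (1 - \<alpha> * \<omega>) *\<^sub>R x" for y
      have Tx: "dist (T y) x \<le> \<alpha> * K" if y: "y \<in> cball x d" for y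
      proof -
        have "T y - x = \<alpha> *\<^sub>R (h y - \<omega> *\<^sub>R x)" by (simp add: T_def algebra_simps)
        then have "dist (T y) x = \<alpha> * norm (h y - \<omega> *\<^sub>R x)" using \<alpha> by (simp add: dist_norm)
        also have "norm (h y - \<omega> *\<^sub>R x) \<le> M + \<bar>\<omega>\<bar> * 1"
        proof -
          have "norm (h y) \<le> M" using M(2) csub y by blast
          moreover have "norm (\<omega> *\<^sub>R x) \<le> \<bar>\<omega>\<bar> * 1"
            unfolding norm_scaleR using x by (intro mult_left_mono) auto
          ultimately show ?thesis using norm_triangle_ineq4[of "h y" "\<omega> *\<^sub>R x"] by linarith
        qed
        also have "M + \<bar>\<omega>\<bar> * 1 \<le> K" by (simp add: K_def)
        finally show ?thesis using \<alpha> by simp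
      qed
      have "\<exists>!y\<in>cball x d. T y = y"
      proof (rule Banach_fix)
        show "complete (cball x d)" by (simp add: complete_eq_closed)
        show "cball x d \<noteq> {}" using d by auto
        show "0 \<le> \<alpha> * (M / d)" using \<alpha> M d by simp
        have "\<alpha> * M \<le> \<alpha> * K" using K \<alpha> by simp
        then show "\<alpha> * (M / d) < 1" using \<alpha>K d by (simp add: divide_less_eq)
        show "T ` cball x d \<subseteq> cball x d"
          using Tx \<alpha>K by (force simp: dist_commute)
        fix y z assume yz: "y \<in> cball x d" "z \<in> cball x d"
        have "dist (T y) (T z) = \<alpha> * norm (h y - h z)"
          using \<alpha> by (simp add: T_def dist_norm flip: scaleR_diff_right)
        also have "\<dots> \<le> \<alpha> * (M / d * norm (y - z))"
          using lip[OF yz] \<alpha> by (intro mult_left_mono) auto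
        finally show "dist (T y) (T z) \<le> \<alpha> * (M / d) * dist y z" by (simp add: dist_norm mult.assoc)
      qed
      then obtain y where y: "y \<in> cball x d" "T y = y" by blast
      have "abel_eq \<omega> h \<alpha> x y"
        unfolding abel_eq_def by (subst (1) y(2)[symmetric]) (simp add: T_def)
      moreover have "y \<in> unit_ball" using y(1) csub sub by blast
      ultimately have "y = \<Phi> \<alpha> x" using \<Phi>(2)[of \<alpha> x y] \<alpha> x by simp
      then show ?thesis using Tx[OF y(1)] y(2) by simp
    qed
    show ?thesis
    proof (rule tendstoI)
      fix e :: real assume e: "e > 0"
      have "eventually (\<lambda>\<alpha>. \<alpha> \<in> {0<..<min (min \<delta> (d / K)) (e / K)}) (at_right 0)"
        using \<delta> d K e by (intro eventually_at_right_real) auto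
      then show "\<forall>\<^sub>F \<alpha> in at_right 0. dist (\<Phi> \<alpha> x) x < e"
      proof eventually_elim
        case (elim \<alpha>)
        then have "dist (\<Phi> \<alpha> x) x \<le> \<alpha> * K" by (intro est) auto
        also have "\<dots> < e" using elim K by (simp add: pos_less_divide_eq)
        finally show ?case .
      qed
    qed
  qed
  have "Re (f (h x)) \<le> \<omega> * (norm x)\<^sup>2 + norm (h 0) * (1 - (norm x)\<^sup>2)"
    if x: "0 < norm x" "norm x < 1" and f: "f \<in> duality_map x" for x f
  proof -
    have f': "f \<in> cdual" "\<And>w. cmod (f w) \<le> norm x * norm w" "f x = complex_of_real ((norm x)\<^sup>2)"
      using f by (simp_all add: duality_map_iff)
    have ineq: "Re (f (h (\<Phi> \<alpha> x))) - \<omega> * (norm x)\<^sup>2 \<le> norm (h (\<Phi> \<alpha> 0)) * (1 - (norm x)\<^sup>2)"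
      if \<alpha>: "0 < \<alpha>" "\<alpha> < \<delta>" for \<alpha>
    proof -
      have eq: "\<Phi> \<alpha> z = \<alpha> *\<^sub>R h (\<Phi> \<alpha> z) + (1 - \<alpha> * \<omega>) *\<^sub>R z" if "z \<in> unit_ball" for z
        using \<Phi>(2)[OF \<alpha> that Hol_mem[OF \<Phi>(1)[OF \<alpha>] that]] by (simp add: abel_eq_def diff_eq_eq add.commute)
      define v where "v = complex_of_real (1 / norm x) *\<^sub>C x"
      have nv: "norm v = 1" and vx: "of_real (norm x) *\<^sub>C v = x"
        using x by (auto simp: v_def norm_scaleC norm_divide scaleC_scaleC)
      define u where "u \<zeta> = f (\<Phi> \<alpha> (0 + \<zeta> *\<^sub>C v)) / of_real (norm x)" for \<zeta>
      have fx: "cmod (f w) / norm x \<le> norm w" for w using f'(2)[of w] x by (simp add: divide_le_eq mult.commute)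
      have "cmod (u (of_real (norm x))) - cmod (of_real (norm x))
          \<le> cmod (u 0) * (1 - (cmod (of_real (norm x)))\<^sup>2)"
      proof (rule Schwarz_Pick_norm)
        have "(\<lambda>\<zeta>. f (\<Phi> \<alpha> (0 + \<zeta> *\<^sub>C v))) holomorphic_on ball 0 1"
          by (rule cdual_Hol_line_holomorphic[OF \<Phi>(1)[OF \<alpha>] f'(1)]) (simp add: norm_scaleC nv)
        then show "u holomorphic_on ball 0 1"
          unfolding u_def using x by (intro holomorphic_on_divide holomorphic_on_const) auto
        fix \<zeta> assume "cmod \<zeta> < 1"
        then have "\<Phi> \<alpha> (0 + \<zeta> *\<^sub>C v) \<in> unit_ball"
          by (intro Hol_mem[OF \<Phi>(1)[OF \<alpha>]]) (simp add: norm_scaleC nv)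
        then show "cmod (u \<zeta>) < 1"
          using fx[of "\<Phi> \<alpha> (0 + \<zeta> *\<^sub>C v)"] by (simp add: u_def norm_divide)
      qed (use x in simp)
      moreover have "cmod (u 0) \<le> norm (\<Phi> \<alpha> 0)" using fx by (simp add: u_def norm_divide)
      \<comment> \<open>The defining equation at 0 supplies the factor \<alpha> that is later
        cancelled.\<close>
      moreover have "norm (\<Phi> \<alpha> 0) = \<alpha> * norm (h (\<Phi> \<alpha> 0))"
        using arg_cong[OF eq[of 0], of norm] \<alpha> by simp
      moreover have "0 \<le> 1 - (norm x)\<^sup>2" using x by (simp add: power_le_one)
      ultimately have "cmod (f (\<Phi> \<alpha> x)) / norm x - norm x \<le> \<alpha> * norm (h (\<Phi> \<alpha> 0)) * (1 - (norm x)\<^sup>2)"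
        using mult_right_mono[of "cmod (u 0)" "norm (\<Phi> \<alpha> 0)" "1 - (norm x)\<^sup>2"]
        by (simp add: u_def vx norm_divide)
      then have "norm x * (cmod (f (\<Phi> \<alpha> x)) / norm x - norm x) \<le> norm x * (\<alpha> * norm (h (\<Phi> \<alpha> 0)) * (1 - (norm x)\<^sup>2))"
        by (intro mult_left_mono) auto
      also have "\<dots> \<le> \<alpha> * norm (h (\<Phi> \<alpha> 0)) * (1 - (norm x)\<^sup>2)"
        using x \<alpha> by (intro mult_left_le_one_le mult_nonneg_nonneg) (auto simp: power_le_one)
      finally have "norm x * (cmod (f (\<Phi> \<alpha> x)) / norm x - norm x) \<le> \<alpha> * norm (h (\<Phi> \<alpha> 0)) * (1 - (norm x)\<^sup>2)" .
      then have "cmod (f (\<Phi> \<alpha> x)) - (norm x)\<^sup>2 \<le> \<alpha> * (norm (h (\<Phi> \<alpha> 0)) * (1 - (norm x)\<^sup>2))"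
        using x by (simp add: power2_eq_square algebra_simps)
      moreover have "Re (f (\<Phi> \<alpha> x)) = \<alpha> * (Re (f (h (\<Phi> \<alpha> x))) - \<omega> * (norm x)\<^sup>2) + (norm x)\<^sup>2"
        using x by (subst eq) (simp_all add: cdualD[OF f'(1)] f'(3) algebra_simps)
      ultimately have "\<alpha> * (Re (f (h (\<Phi> \<alpha> x))) - \<omega> * (norm x)\<^sup>2) \<le> \<alpha> * (norm (h (\<Phi> \<alpha> 0)) * (1 - (norm x)\<^sup>2))"
        using complex_Re_le_cmod[of "f (\<Phi> \<alpha> x)"] by linarith
      then show ?thesis using \<alpha> by simp
    qed
    have hlim: "((\<lambda>\<alpha>. h (\<Phi> \<alpha> z)) \<longlongrightarrow> h z) (at_right 0)" if "z \<in> unit_ball" for z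
      using isCont_tendsto_compose[OF Hol_continuous[OF h that] lim[OF that]] .
    have "((\<lambda>\<alpha>. Re (f (h (\<Phi> \<alpha> x))) - \<omega> * (norm x)\<^sup>2) \<longlongrightarrow> Re (f (h x)) - \<omega> * (norm x)\<^sup>2) (at_right 0)"
      using x by (intro tendsto_intros bounded_linear.tendsto[OF cdualD(1)[OF f'(1)]] hlim) auto
    moreover have "((\<lambda>\<alpha>. norm (h (\<Phi> \<alpha> 0)) * (1 - (norm x)\<^sup>2)) \<longlongrightarrow> norm (h 0) * (1 - (norm x)\<^sup>2)) (at_right 0)"
      by (intro tendsto_intros hlim) auto
    moreover have "\<forall>\<^sub>F \<alpha> in at_right 0. Re (f (h (\<Phi> \<alpha> x))) - \<omega> * (norm x)\<^sup>2 \<le> norm (h (\<Phi> \<alpha> 0)) * (1 - (norm x)\<^sup>2)"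
      using eventually_at_right_real[OF \<delta>(1)] by eventually_elim (use ineq in auto)
    ultimately have "Re (f (h x)) - \<omega> * (norm x)\<^sup>2 \<le> norm (h 0) * (1 - (norm x)\<^sup>2)"
      using tendsto_le[OF trivial_limit_at_right_real] by blast
    then show ?thesis by simp
  qed
  then show ?thesis
    unfolding dissipative_def
    \<comment> \<open>With \<open>1\<close> for \<epsilon> the shell is the whole ball without the
      origin.\<close>
    by (intro exI[of _ "1 :: real"] conjI exI[of _ "norm (h 0)"]) auto
qed

text \<open>The coercivity constant degenerates as \<open>norm x\<close> tends to 1. The equation is
  therefore solved for \<open>x\<close> in each ball of radius \<open>\<kappa> < 1\<close>, and
  uniqueness glues the solutions together.\<close>

lemma dissipative_imp_pseudo_contractive:
  fixes h :: "'a::complex_banach \<Rightarrow> 'a"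
  assumes h: "h \<in> Hol unit_ball UNIV" and diss: "dissipative \<omega> h"
  shows "pseudo_contractive \<omega> h"
proof -
  obtain \<epsilon> \<sigma> where \<epsilon>: "\<epsilon> > 0" and d: "\<And>x f. 1 - \<epsilon> < norm x \<Longrightarrow> norm x < 1 \<Longrightarrow> f \<in> duality_map x \<Longrightarrow>
      Re (f (h x)) \<le> \<omega> * (norm x)\<^sup>2 + \<sigma> * (1 - (norm x)\<^sup>2)"
    using diss unfolding dissipative_def by force
  have hb: "\<exists>M. \<forall>z. norm z \<le> \<rho> \<longrightarrow> norm (h z) \<le> M" if \<rho>: "\<rho> < 1" for \<rho>
  proof -
    have "\<exists>C. \<forall>z l. norm z \<le> r \<longrightarrow> l \<in> duality_map z \<longrightarrow> cmod (l (h z)) \<le> C * norm z" if "r < 1" for r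
      using dissipative_numerical_bound[OF h diss that] by metis
    then show ?thesis using bounded_of_numerical_bound[OF h _ \<rho>] by metis
  qed
  have main: "\<exists>r0<1. \<forall>r. r0 < r \<longrightarrow> r < 1 \<longrightarrow> (\<exists>y. y \<in> Hol (ball 0 \<kappa>) (ball 0 r) \<and>
      (\<forall>x\<in>ball 0 \<kappa>. \<forall>z\<in>ball 0 r. abel_eq \<omega> h \<alpha> x z \<longleftrightarrow> z = y x))"
    if \<alpha>: "0 < \<alpha>" "\<alpha> * \<omega> < 1" and \<kappa>: "0 < \<kappa>" "\<kappa> < 1" for \<alpha> \<kappa>
  proof -
    \<comment> \<open>\<open>g (norm z)\<close> is the lower bound for the real part that
      dissipativity gives. At the sphere it equals
      \<open>(1 - \<alpha> * \<omega>) * (1 - \<kappa>)\<close>; \<open>c\<close> is half of that,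
      leaving room for a shell.\<close>
    define g where "g t = (1 - \<alpha> * \<omega>) * t\<^sup>2 - \<alpha> * \<sigma> * (1 - t\<^sup>2) - (1 - \<alpha> * \<omega>) * \<kappa> * t" for t :: real
    define c where "c = (1 - \<alpha> * \<omega>) * (1 - \<kappa>) / 2"
    have c: "0 < c" using \<alpha> \<kappa> by (simp add: c_def)
    have "(g \<longlongrightarrow> g 1) (at_left 1)" unfolding g_def by (intro tendsto_intros)
    moreover have "c < g 1" using c by (simp add: g_def c_def field_simps)
    ultimately have "\<forall>\<^sub>F t in at_left 1. c < g t" by (rule order_tendstoD(1))
    then obtain b where b: "b < 1" "\<And>t. b < t \<Longrightarrow> t < 1 \<Longrightarrow> c < g t"
      unfolding eventually_at_left_field by metis
    define r0 where "r0 = max (max b (1 - \<epsilon>)) 0"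
    have r0: "0 \<le> r0" "r0 < 1" "b \<le> r0" "1 - \<epsilon> \<le> r0" using b \<epsilon> by (auto simp: r0_def)
    show ?thesis
    proof (intro exI[of _ r0] conjI allI impI r0)
      fix r assume r: "r0 < r" "r < 1"
      define r1 where "r1 = (r0 + r) / 2"
      define r2 where "r2 = (r + 1) / 2"
      have r12: "0 < r1" "r1 < r" "r < r2" "r2 \<le> 1" "r0 < r1" "r2 < 1" using r r0 by (auto simp: r1_def r2_def)
      obtain M where M: "\<And>z. norm z \<le> r2 \<Longrightarrow> norm (h z) \<le> M" using hb[OF r12(6)] by blast
      define f where "f x z = z - \<alpha> *\<^sub>R h z - (1 - \<alpha> * \<omega>) *\<^sub>R x" for x z
      have hr: "h \<in> Hol (ball 0 r2) UNIV" by (rule Hol_mono[OF h]) (use r12 in auto)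
      have x1: "norm ((1 - \<alpha> * \<omega>) *\<^sub>R x) \<le> (1 - \<alpha> * \<omega>) * \<kappa>" if "x \<in> ball 0 \<kappa>" for x :: 'a
        unfolding norm_scaleR using that \<alpha> by (simp add: mult_left_mono)
      obtain y where y: "y \<in> Hol (ball 0 \<kappa>) (ball 0 r)"
        "\<And>x z. x \<in> ball 0 \<kappa> \<Longrightarrow> z \<in> ball 0 r \<Longrightarrow> f x z = 0 \<longleftrightarrow> z = y x"
      proof (rule null_point_ball[OF r12(1-4) open_ball])
        fix x :: 'a assume x: "x \<in> ball 0 \<kappa>"
        show "f x \<in> Hol (ball 0 r2) UNIV"
          unfolding f_def by (rule Hol_diff[OF Hol_diff[OF Hol_ident Hol_scaleR[OF hr]] Hol_const[OF UNIV_I]])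
      next
        fix x z :: 'a assume x: "x \<in> ball 0 \<kappa>" and z: "z \<in> ball 0 r2"
        have "norm (f x z) \<le> norm z + \<alpha> * norm (h z) + norm ((1 - \<alpha> * \<omega>) *\<^sub>R x)"
          unfolding f_def
          using norm_triangle_ineq4[of "z - \<alpha> *\<^sub>R h z" "(1 - \<alpha> * \<omega>) *\<^sub>R x"] norm_triangle_ineq4[of z "\<alpha> *\<^sub>R h z"] \<alpha>
          by simp
        also have "\<dots> \<le> 1 + \<alpha> * M + (1 - \<alpha> * \<omega>) * \<kappa>"
          using z r12 x1[OF x] M[of z] \<alpha> by (intro add_mono mult_left_mono) auto
        finally show "norm (f x z) \<le> 1 + \<alpha> * M + (1 - \<alpha> * \<omega>) * \<kappa>" .
      next
        show "0 < c" by (rule c)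
      next
        fix x z :: 'a and l
        assume x: "x \<in> ball 0 \<kappa>" and z: "r1 \<le> norm z" "norm z < r2" and l: "l \<in> duality_map z"
        then have l': "l \<in> cdual" "\<And>w. cmod (l w) \<le> norm z * norm w" "l z = complex_of_real ((norm z)\<^sup>2)"
          by (simp_all add: duality_map_iff)
        have "\<alpha> * Re (l (h z)) \<le> \<alpha> * (\<omega> * (norm z)\<^sup>2 + \<sigma> * (1 - (norm z)\<^sup>2))"
          using d[OF _ _ l] z r12 r0 \<alpha> by (intro mult_left_mono) auto
        moreover have "Re (l ((1 - \<alpha> * \<omega>) *\<^sub>R x)) \<le> norm z * ((1 - \<alpha> * \<omega>) * \<kappa>)"
          using l'(2)[of "(1 - \<alpha> * \<omega>) *\<^sub>R x"] mult_left_mono[OF x1[OF x], of "norm z"]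
            complex_Re_le_cmod[of "l ((1 - \<alpha> * \<omega>) *\<^sub>R x)"] by simp
        moreover have "Re (l (f x z)) = (norm z)\<^sup>2 - \<alpha> * Re (l (h z)) - Re (l ((1 - \<alpha> * \<omega>) *\<^sub>R x))"
          unfolding f_def cdualD(4)[OF l'(1)] by (simp add: cdualD(6)[OF l'(1)] l'(3))
        ultimately have "g (norm z) \<le> Re (l (f x z))" by (simp add: g_def algebra_simps)
        moreover have "c < g (norm z)" using b(2)[of "norm z"] z r12 r0 by simp
        ultimately show "c \<le> Re (l (f x z))" by simp
      next
        fix y :: "'a \<Rightarrow> 'a" assume y: "y \<in> Hol (ball 0 \<kappa>) (ball 0 r)"
        have "y \<in> Hol (ball 0 \<kappa>) (ball 0 r2)"
          by (rule Hol_mono[OF y order_refl]) (use Hol_mem[OF y] r12 in fastforce)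
        then show "(\<lambda>x. f x (y x)) \<in> Hol (ball 0 \<kappa>) UNIV"
          unfolding f_def
          by (intro Hol_diff[OF Hol_diff[OF y Hol_scaleR[OF Hol_compose[OF _ hr]]] Hol_scaleR[OF Hol_ident]])
      qed blast+
      have "abel_eq \<omega> h \<alpha> x z \<longleftrightarrow> f x z = 0" for x z by (simp add: abel_eq_def f_def)
      with y show "\<exists>y. y \<in> Hol (ball 0 \<kappa>) (ball 0 r) \<and>
        (\<forall>x\<in>ball 0 \<kappa>. \<forall>z\<in>ball 0 r. abel_eq \<omega> h \<alpha> x z \<longleftrightarrow> z = y x)" by blast
    qed
  qed
  have "abel_average_in_Hol \<omega> h \<alpha>" if \<alpha>: "0 < \<alpha>" "\<alpha> * \<omega> < 1" for \<alpha>
  proof -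
    have local: "\<exists>y. y \<in> Hol (ball 0 \<kappa>) unit_ball \<and>
        (\<forall>x\<in>ball 0 \<kappa>. \<forall>z\<in>unit_ball. abel_eq \<omega> h \<alpha> x z \<longleftrightarrow> z = y x)" if \<kappa>: "0 < \<kappa>" "\<kappa> < 1" for \<kappa>
    proof -
      obtain r0 where r0: "r0 < 1" "\<And>r. r0 < r \<Longrightarrow> r < 1 \<Longrightarrow> \<exists>y. y \<in> Hol (ball 0 \<kappa>) (ball 0 r) \<and>
        (\<forall>x\<in>ball 0 \<kappa>. \<forall>z\<in>ball 0 r. abel_eq \<omega> h \<alpha> x z \<longleftrightarrow> z = y x)"
        using main[OF \<alpha> \<kappa>] by blast
      define r where "r = (r0 + 1) / 2"
      have r: "r0 < r" "r < 1" using r0 by (auto simp: r_def)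
      obtain y where y: "y \<in> Hol (ball 0 \<kappa>) (ball 0 r)"
        "\<And>x z. x \<in> ball 0 \<kappa> \<Longrightarrow> z \<in> ball 0 r \<Longrightarrow> abel_eq \<omega> h \<alpha> x z \<longleftrightarrow> z = y x"
        using r0(2)[OF r] by blast
      have yr: "norm (y x) < r" if "x \<in> ball 0 \<kappa>" for x using Hol_mem[OF y(1) that] by simp
      have "abel_eq \<omega> h \<alpha> x z \<longleftrightarrow> z = y x" if x: "x \<in> ball 0 \<kappa>" and z: "z \<in> unit_ball" for x z
      proof -
        \<comment> \<open>A larger radius that also contains \<open>z\<close>: uniqueness in
          \<open>ball 0 t\<close> extends uniqueness from \<open>ball 0 r\<close> to the unit
          ball.\<close>
        define t where "t = max r ((norm z + 1) / 2)"
        have t: "r0 < t" "t < 1" "r \<le> t" "norm z < t" using r z by (auto simp: t_def less_max_iff_disj)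
        obtain y' where y': "\<And>x z. x \<in> ball 0 \<kappa> \<Longrightarrow> z \<in> ball 0 t \<Longrightarrow> abel_eq \<omega> h \<alpha> x z \<longleftrightarrow> z = y' x"
          using r0(2)[OF t(1,2)] by blast
        have "abel_eq \<omega> h \<alpha> x (y x)" using y(2)[OF x, of "y x"] yr[OF x] by simp
        then have "y x = y' x" using y'[OF x, of "y x"] yr[OF x] t by simp
        then show ?thesis using y'[OF x, of z] t by simp
      qed
      moreover have "y \<in> Hol (ball 0 \<kappa>) unit_ball"
        by (rule Hol_mono[OF y(1) order_refl]) (use yr r in fastforce)
      ultimately show ?thesis by blast
    qed
    have pt: "\<exists>\<kappa> y. x \<in> ball 0 \<kappa> \<and> ball 0 \<kappa> \<subseteq> (unit_ball :: 'a set) \<and> y \<in> Hol (ball 0 \<kappa>) unit_ball \<and>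
        (\<forall>x\<in>ball 0 \<kappa>. \<forall>z\<in>unit_ball. abel_eq \<omega> h \<alpha> x z \<longleftrightarrow> z = y x)" if "x \<in> unit_ball" for x
    proof -
      define \<kappa> where "\<kappa> = (norm x + 1) / 2"
      have \<kappa>: "0 < \<kappa>" "\<kappa> < 1" "norm x < \<kappa>" using that norm_ge_zero[of x] by (auto simp: \<kappa>_def simp del: norm_ge_zero)
      show ?thesis using local[OF \<kappa>(1,2)] \<kappa> by (intro exI[of _ \<kappa>]) auto
    qed
    have ex1: "\<exists>!y. y \<in> unit_ball \<and> abel_eq \<omega> h \<alpha> x y" if x: "x \<in> unit_ball" for x
    proof -
      obtain \<kappa> y where y: "x \<in> ball 0 \<kappa>" "y \<in> Hol (ball 0 \<kappa>) unit_ball"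
        "\<And>z. z \<in> unit_ball \<Longrightarrow> abel_eq \<omega> h \<alpha> x z \<longleftrightarrow> z = y x" using pt[OF x] by blast
      show ?thesis using y(3) Hol_mem[OF y(2,1)] by blast
    qed
    have avg: "abel_average \<omega> h \<alpha> x = z" if "x \<in> unit_ball" "z \<in> unit_ball" "abel_eq \<omega> h \<alpha> x z" for x z
      unfolding abel_average_def by (rule the1_equality[OF ex1[OF that(1)]]) (use that in blast)
    have "abel_average \<omega> h \<alpha> \<in> Hol unit_ball unit_ball"
      unfolding Hol_def
    proof safe
      fix x :: 'a assume x: "x \<in> unit_ball"
      obtain \<kappa> y where y: "x \<in> ball 0 \<kappa>" "ball 0 \<kappa> \<subseteq> (unit_ball :: 'a set)" "y \<in> Hol (ball 0 \<kappa>) unit_ball"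
        "\<And>x z. x \<in> ball 0 \<kappa> \<Longrightarrow> z \<in> unit_ball \<Longrightarrow> abel_eq \<omega> h \<alpha> x z \<longleftrightarrow> z = y x" using pt[OF x] by blast
      have "abel_average \<omega> h \<alpha> x' = y x'" if "x' \<in> ball 0 \<kappa>" for x'
        by (rule avg) (use y Hol_mem[OF y(3) that] that in blast)+
      then have "abel_average \<omega> h \<alpha> \<in> Hol (ball 0 \<kappa>) unit_ball"
        by (rule Hol_cong[OF y(3) open_ball])
      then show "abel_average \<omega> h \<alpha> x \<in> unit_ball"
        "\<exists>f'. bounded_clinear f' \<and> (abel_average \<omega> h \<alpha> has_derivative f') (at x)"
        using y(1) unfolding Hol_def by blast+
    qed
    with ex1 \<alpha> show ?thesis unfolding abel_average_in_Hol_def by auto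
  qed
  moreover have "\<alpha> * \<omega> < 1" if "0 < \<alpha>" "\<alpha> < 1 / (\<bar>\<omega>\<bar> + 1)" for \<alpha>
  proof -
    have "\<alpha> * \<omega> \<le> \<alpha> * \<bar>\<omega>\<bar>" using that by (intro mult_left_mono) auto
    also have "\<dots> \<le> \<alpha> * (\<bar>\<omega>\<bar> + 1)" using that by simp
    also have "\<dots> < 1" using that by (simp add: pos_less_divide_eq)
    finally show ?thesis .
  qed
  ultimately show ?thesis
    unfolding pseudo_contractive_def by (intro exI[of _ "1 / (\<bar>\<omega>\<bar> + 1)"]) auto
qed

theorem corollary1p9:
  fixes \<omega> :: real
    and h :: "'a::complex_banach \<Rightarrow> 'a"
  assumes "weakly_sequentially_complete TYPE('a)"
    and "h \<in> Hol unit_ball UNIV"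
  shows "dissipative \<omega> h \<longleftrightarrow> pseudo_contractive \<omega> h"
  using dissipative_imp_pseudo_contractive[OF assms(2)] pseudo_contractive_imp_dissipative[OF assms(2)]
  by blast

end
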